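(* Let $L_0$ be a selfadjoint operator with dense domain in a Hilbert space $H$, having simple discrete spectrum $\sigma(L_0)=\{\lambda_k:k\in\mathbb{Z}\}$, where the real numbers $\lambda_k$ are enumerated in ascending order and have no finite limit points. Let $\mu\in\mathbb{R}$, $v\in H$, and let $L=L_0+\mu\langle\cdot,v\rangle v$ with domain $\mathfrak{D}(L)=\mathfrak{D}(L_0)$. With $\sigma_0$ and $\sigma_2$ as defined in the context, the spectrum of $L$ is $$\sigma(L)=\{\sigma_0\setminus(\sigma_0\cap\sigma_2)\}\cup\{\sigma_2\setminus(\sigma_0\cap\sigma_2)\}\cup\{\sigma_0\cap\sigma_2\},$$ where the points of $\sigma_0\setminus(\sigma_0\cap\sigma_2)$ and of $\sigma_2\setminus(\sigma_0\cap\sigma_2)$ are of multiplicity $1$ and the points of $\sigma_0\cap\sigma_2$ are of multiplicity $2$.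
   Context: Let $\{u_k\}_{k\in\mathbb{Z}}$ be the orthonormal eigenvectors of $L_0$, $L_0u_k=\lambda_ku_k$, so that $L_0=\sum_k\lambda_k\langle\cdot,u_k\rangle u_k$, and put $v_k=\langle v,u_k\rangle$. Define $\sigma_0=\{\lambda_k\in\sigma(L_0):v_k=0\}$ and $\sigma_1=\{\lambda_k\in\sigma(L_0):v_k\neq0\}$. The function $Q$ is $$Q(\lambda)=1+\mu\langle (L_0-\lambda I)^{-1}v,v\rangle=1+\mu\sum_{s:\,\lambda_s\in\sigma_1}\frac{|v_s|^2}{\lambda_s-\lambda},$$ and $\sigma_2$ is the set of zeros of $Q$. Points of $\sigma_2$ may coincide with points of $\sigma_0$.
   Formalization: The case μ = 0 with v ≠ 0 is excluded, since there Q = 1, σ₂ is empty and L = L₀, so σ(L) also contains the nonempty set σ₁ and the stated formula fails. *)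

theory Defs
  imports "HOL-Analysis.Analysis"
begin

section \<open>Complex Hilbert spaces\<close>

text \<open>The inner product is linear in its first argument and conjugate-linear in the second.\<close>

class complex_inner_space = real_normed_vector +
  fixes scaleC :: "complex \<Rightarrow> 'a \<Rightarrow> 'a"  (infixr "*\<^sub>C" 75)
    and cinner :: "'a \<Rightarrow> 'a \<Rightarrow> complex"
  assumes scaleC_add_right: "a *\<^sub>C (x + y) = a *\<^sub>C x + a *\<^sub>C y"
    and scaleC_add_left: "(a + b) *\<^sub>C x = a *\<^sub>C x + b *\<^sub>C x"
    and scaleC_scaleC: "a *\<^sub>C b *\<^sub>C x = (a * b) *\<^sub>C x"
    and scaleC_one: "1 *\<^sub>C x = x"
    and scaleR_scaleC: "r *\<^sub>R x = complex_of_real r *\<^sub>C x"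
    and cinner_add_left: "cinner (x + y) z = cinner x z + cinner y z"
    and cinner_scaleC_left: "cinner (a *\<^sub>C x) y = a * cinner x y"
    and cinner_commute: "cinner x y = cnj (cinner y x)"
    and cinner_self_nonneg: "0 \<le> Re (cinner x x)"
    and cinner_self_eq_0_iff: "cinner x x = 0 \<longleftrightarrow> x = 0"
    and norm_eq_sqrt_cinner: "norm x = sqrt (Re (cinner x x))"

class complex_hilbert_space = complex_inner_space + complete_space

global_interpretation complex_vector:
  vector_space "scaleC :: complex \<Rightarrow> 'a \<Rightarrow> 'a::complex_inner_space"
  by unfold_locales
    (simp_all add: scaleC_add_right scaleC_add_left scaleC_scaleC scaleC_one)


section \<open>Unbounded operators\<close>

text \<open>An operator is a domain \<open>D\<close> together with a function \<open>A\<close>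
  whose values outside \<open>D\<close> are irrelevant.\<close>

definition linear_operator :: "'a::complex_inner_space set \<Rightarrow> ('a \<Rightarrow> 'a) \<Rightarrow> bool" where
  "linear_operator D A \<longleftrightarrow>
     complex_vector.subspace D \<and>
     (\<forall>x\<in>D. \<forall>y\<in>D. A (x + y) = A x + A y) \<and>
     (\<forall>c. \<forall>x\<in>D. A (c *\<^sub>C x) = c *\<^sub>C A x)"

definition op_graph :: "'a set \<Rightarrow> ('a \<Rightarrow> 'a) \<Rightarrow> ('a \<times> 'a) set" where
  "op_graph D A = {(x, A x) | x. x \<in> D}"

definition adjoint_graph ::
    "'a::complex_inner_space set \<Rightarrow> ('a \<Rightarrow> 'a) \<Rightarrow> ('a \<times> 'a) set" where
  "adjoint_graph D A = {(y, z). \<forall>x\<in>D. cinner (A x) y = cinner x z}"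

definition selfadjoint :: "'a::complex_inner_space set \<Rightarrow> ('a \<Rightarrow> 'a) \<Rightarrow> bool" where
  "selfadjoint D A \<longleftrightarrow>
     linear_operator D A \<and> closure D = UNIV \<and> adjoint_graph D A = op_graph D A"

definition resolvent_set ::
    "'a::complex_inner_space set \<Rightarrow> ('a \<Rightarrow> 'a) \<Rightarrow> complex set" where
  "resolvent_set D A =
     {z. bij_betw (\<lambda>x. A x - z *\<^sub>C x) D UNIV \<and>
         (\<exists>C. \<forall>x\<in>D. norm x \<le> C * norm (A x - z *\<^sub>C x))}"

definition spectrum ::
    "'a::complex_inner_space set \<Rightarrow> ('a \<Rightarrow> 'a) \<Rightarrow> complex set" where
  "spectrum D A = - resolvent_set D A"

definition eigenspace ::
    "'a::complex_inner_space set \<Rightarrow> ('a \<Rightarrow> 'a) \<Rightarrow> complex \<Rightarrow> 'a set" where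
  "eigenspace D A z = {x \<in> D. A x = z *\<^sub>C x}"

text \<open>For selfadjoint operators geometric and algebraic multiplicity agree. Note that
  \<open>dim\<close> is \<open>0\<close> for infinite-dimensional spaces, so only positive values are informative.\<close>

definition eigenvalue_multiplicity ::
    "'a::complex_inner_space set \<Rightarrow> ('a \<Rightarrow> 'a) \<Rightarrow> complex \<Rightarrow> nat" where
  "eigenvalue_multiplicity D A z = complex_vector.dim (eigenspace D A z)"

definition simple_discrete_spectrum ::
    "'a::complex_inner_space set \<Rightarrow> ('a \<Rightarrow> 'a) \<Rightarrow> (int \<Rightarrow> real) \<Rightarrow> bool" where
  "simple_discrete_spectrum D A lam \<longleftrightarrow>
     spectrum D A = range (\<lambda>k. complex_of_real (lam k)) \<and>
     strict_mono lam \<and>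
     (\<forall>x. \<not> x islimpt range lam) \<and>
     (\<forall>k. eigenvalue_multiplicity D A (complex_of_real (lam k)) = 1)"

definition orthonormal_eigenvectors ::
    "'a::complex_inner_space set \<Rightarrow> ('a \<Rightarrow> 'a) \<Rightarrow> (int \<Rightarrow> real) \<Rightarrow> (int \<Rightarrow> 'a) \<Rightarrow> bool" where
  "orthonormal_eigenvectors D A lam u \<longleftrightarrow>
     (\<forall>k. u k \<in> D \<and> A (u k) = complex_of_real (lam k) *\<^sub>C u k) \<and>
     (\<forall>j k. cinner (u j) (u k) = (if j = k then 1 else 0))"


section \<open>Rank-one perturbations\<close>

definition rank_one_perturbation ::
    "('a::complex_inner_space \<Rightarrow> 'a) \<Rightarrow> real \<Rightarrow> 'a \<Rightarrow> 'a \<Rightarrow> 'a" where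
  "rank_one_perturbation A mu v = (\<lambda>x. A x + complex_of_real mu *\<^sub>C cinner x v *\<^sub>C v)"

text \<open>For \<open>\<mu> = 0\<close> and \<open>v \<noteq> 0\<close> the set \<open>\<sigma>\<^sub>2\<close> below is empty, while the spectrum of the (unchanged)
  operator also contains \<open>\<sigma>\<^sub>1 \<noteq> {}\<close>. A description of the perturbed spectrum through
  \<open>\<sigma>\<^sub>0\<close> and \<open>\<sigma>\<^sub>2\<close> alone therefore has to exclude exactly this degenerate case.\<close>

definition sigma0 ::
    "(int \<Rightarrow> real) \<Rightarrow> (int \<Rightarrow> 'a::complex_inner_space) \<Rightarrow> 'a \<Rightarrow> complex set" where
  "sigma0 lam u v = {complex_of_real (lam k) | k. cinner v (u k) = 0}"

definition sigma1 ::
    "(int \<Rightarrow> real) \<Rightarrow> (int \<Rightarrow> 'a::complex_inner_space) \<Rightarrow> 'a \<Rightarrow> complex set" where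
  "sigma1 lam u v = {complex_of_real (lam k) | k. cinner v (u k) \<noteq> 0}"

text \<open>The series extends \<open>1 + \<mu> \<langle>(L\<^sub>0 - z)\<inverse> v, v\<rangle>\<close> from the resolvent set of
  \<open>L\<^sub>0\<close> to the complement of \<open>\<sigma>\<^sub>1\<close>. The points of \<open>\<sigma>\<^sub>1\<close> are poles of \<open>Q\<close>; since division
  by zero yields zero, they must be excluded explicitly from its zero set \<open>\<sigma>\<^sub>2\<close>.\<close>

definition Q_fun ::
    "(int \<Rightarrow> real) \<Rightarrow> (int \<Rightarrow> 'a::complex_inner_space) \<Rightarrow> real \<Rightarrow> 'a \<Rightarrow> complex \<Rightarrow> complex" where
  "Q_fun lam u mu v z =
     1 + complex_of_real mu *
       (\<Sum>\<^sub>\<infinity>s\<in>{s. complex_of_real (lam s) \<in> sigma1 lam u v}.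
          complex_of_real ((cmod (cinner v (u s)))\<^sup>2) / (complex_of_real (lam s) - z))"

definition sigma2 ::
    "(int \<Rightarrow> real) \<Rightarrow> (int \<Rightarrow> 'a::complex_inner_space) \<Rightarrow> real \<Rightarrow> 'a \<Rightarrow> complex set" where
  "sigma2 lam u mu v = {z. z \<notin> sigma1 lam u v \<and> Q_fun lam u mu v z = 0}"

end

theory Submission
  imports Defs
begin

text \<open>The eigenvectors \<open>u\<^sub>k\<close> are complete: the orthogonal complement of their span is invariant under
  the resolvent, whose norm there would be attained in the approximate point spectrum, that is, at some
  \<open>\<lambda>\<^sub>j\<close>; but an isolated simple eigenvalue is bounded away from zero on the complement of its
  eigenvector. So \<open>L\<^sub>0 - z\<close> can be inverted coefficientwise whenever the right-hand side is orthogonal to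
  its kernel. If \<open>z \<notin> \<sigma>\<^sub>1\<close>, this applies to \<open>v\<close> and gives \<open>y\<close> with \<open>(L\<^sub>0 - z) y = v\<close> and
  \<open>Q(z) = 1 + \<mu>\<langle>y, v\<rangle>\<close>, and the kernel of \<open>L - z\<close> consists of the vectors \<open>x + b y\<close> with
  \<open>x\<close> in the kernel of \<open>L\<^sub>0 - z\<close> and \<open>b Q(z) = 0\<close>. If \<open>z = \<lambda>\<^sub>k \<in> \<sigma>\<^sub>1\<close>, taking the inner product with
  \<open>u\<^sub>k\<close> determines \<open>\<langle>x, v\<rangle>\<close> in \<open>(L - z) x = f\<close>, so that \<open>L - z\<close> is invertible.\<close>

section \<open>Complex inner product spaces\<close>

instance complex_hilbert_space \<subseteq> banach ..

lemma cinner_add_right: "cinner x (y + z) = cinner x y + cinner x z"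
  by (metis cinner_add_left cinner_commute complex_cnj_add)

lemma cinner_scaleC_right: "cinner x (a *\<^sub>C y) = cnj a * cinner x y"
  by (metis cinner_commute cinner_scaleC_left complex_cnj_mult)

lemma cinner_self: "cinner x x = complex_of_real ((norm x)\<^sup>2)"
proof -
  have "Im (cinner x x) = 0"
    using arg_cong[OF cinner_commute[of x x], of Im] by simp
  then show ?thesis
    using cinner_self_nonneg[of x] by (simp add: complex_eq_iff norm_eq_sqrt_cinner)
qed

lemma Re_cinner_commute: "Re (cinner x y) = Re (cinner y x)"
  by (subst cinner_commute) simp

lemma norm_scaleC: "norm (a *\<^sub>C x) = cmod a * norm x"
proof -
  have "cinner (a *\<^sub>C x) (a *\<^sub>C x) = (a * cnj a) * cinner x x"
    by (simp add: cinner_scaleC_left cinner_scaleC_right)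
  then have "complex_of_real ((norm (a *\<^sub>C x))\<^sup>2) = complex_of_real ((cmod a)\<^sup>2 * (norm x)\<^sup>2)"
    unfolding cinner_self by (simp only: complex_norm_square[symmetric] of_real_mult)
  then have "(norm (a *\<^sub>C x))\<^sup>2 = (cmod a * norm x)\<^sup>2"
    by (simp only: of_real_eq_iff power_mult_distrib)
  then show ?thesis
    by (simp add: power2_eq_iff_nonneg)
qed

lemma norm_diff_sq: "(norm (x - y))\<^sup>2 = (norm x)\<^sup>2 - 2 * Re (cinner x y) + (norm y)\<^sup>2"
  for x y :: "'a::complex_inner_space"
proof -
  have "cinner (x - y) (x - y) = cinner x x - cinner x y - cinner y x + cinner y y"
    using cinner_add_left[of "x - y" y "x - y"] cinner_add_right[of x "x - y" y]
      cinner_add_right[of y "x - y" y] by (simp add: algebra_simps)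
  from arg_cong[OF this, of Re] show ?thesis
    using Re_cinner_commute[of y x] by (simp add: cinner_self)
qed

lemma cinner_Cauchy_Schwarz: "cmod (cinner x y) \<le> norm x * norm y"
proof (cases "y = 0")
  case True
  have "cinner x 0 = 0"
    using cinner_scaleC_right[of x 0 0] by simp
  with True show ?thesis by simp
next
  case False
  \<comment> \<open>Here \<open>a\<close> is the coefficient of the orthogonal projection of
    \<open>x\<close> onto the line through \<open>y\<close>; the squared norm of the remainder being
    nonnegative is the inequality.\<close>
  define a where "a = cinner x y / complex_of_real ((norm y)\<^sup>2)"
  have "cnj a * cinner x y = complex_of_real ((cmod (cinner x y))\<^sup>2 / (norm y)\<^sup>2)"
    unfolding a_def by (simp add: complex_norm_square[of "cinner x y"] mult.commute del: of_real_power)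
  moreover have "cmod a * norm y = cmod (cinner x y) / norm y"
    using False by (simp add: a_def norm_divide power2_eq_square norm_mult)
  moreover have "0 \<le> (norm (x - a *\<^sub>C y))\<^sup>2" by simp
  ultimately have "0 \<le> (norm x)\<^sup>2 - (cmod (cinner x y) / norm y)\<^sup>2"
    unfolding norm_diff_sq norm_scaleC cinner_scaleC_right by (simp add: power_divide del: of_real_power)
  then have "cmod (cinner x y) / norm y \<le> norm x"
    using power2_le_imp_le[of "cmod (cinner x y) / norm y" "norm x"] by simp
  then show ?thesis
    using False by (simp add: field_simps)
qed

text \<open>Regarded over the reals, the form is bilinear despite being conjugate-linear in its
  second argument. This gives continuity and the rules for sums, differences and real
  scalars.\<close>

interpretation cinner: bounded_bilinear "cinner :: 'a::complex_inner_space \<Rightarrow> 'a \<Rightarrow> complex"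
proof
  show "\<exists>K. \<forall>(a::'a) b. norm (cinner a b) \<le> norm a * norm b * K"
    by (intro exI[of _ 1]) (simp add: cinner_Cauchy_Schwarz)
qed (simp_all add: cinner_add_left cinner_add_right cinner_scaleC_left cinner_scaleC_right
      scaleR_scaleC[where 'a='a] scaleR_conv_of_real)

lemma bounded_linear_scaleC: "bounded_linear (\<lambda>x. a *\<^sub>C x)"
  by (rule bounded_linear_intro[where K = "cmod a"])
    (simp_all add: scaleC_add_right scaleR_scaleC scaleC_scaleC norm_scaleC mult.commute)

section \<open>Orthonormal families: Pythagoras, Bessel and unconditional convergence\<close>

lemma norm_sum_orthonormal_sq:
  fixes u :: "'i \<Rightarrow> 'a::complex_inner_space"
  assumes "\<And>j k. cinner (u j) (u k) = (if j = k then 1 else 0)" "finite F"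
  shows "(norm (\<Sum>k\<in>F. a k *\<^sub>C u k))\<^sup>2 = (\<Sum>k\<in>F. (cmod (a k))\<^sup>2)"
proof -
  have "cinner (\<Sum>k\<in>F. a k *\<^sub>C u k) (\<Sum>k\<in>F. a k *\<^sub>C u k)
      = (\<Sum>k\<in>F. \<Sum>j\<in>F. if j = k then a k * cnj (a k) else 0)"
    unfolding cinner.sum_left cinner.sum_right cinner_scaleC_left cinner_scaleC_right assms(1)
    by (intro sum.cong refl) (auto simp: sum_distrib_left intro!: sum.cong)
  also have "\<dots> = (\<Sum>k\<in>F. complex_of_real ((cmod (a k))\<^sup>2))"
    using assms(2) by (simp add: complex_norm_square del: of_real_power)
  finally show ?thesis
    unfolding cinner_self by (metis of_real_eq_iff of_real_sum)
qed

lemma has_sum_cinner_left: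
  assumes "(f has_sum x) A"
  shows "((\<lambda>k. cinner (f k) y) has_sum cinner x y) A"
  using has_sum_bounded_linear[OF cinner.bounded_linear_left assms] .

lemma cinner_has_sum_orthonormal:
  fixes u :: "'i \<Rightarrow> 'a::complex_inner_space"
  assumes "\<And>j k. cinner (u j) (u k) = (if j = k then 1 else 0)"
    and "((\<lambda>k. a k *\<^sub>C u k) has_sum x) UNIV"
  shows "cinner x (u j) = a j"
proof -
  have "((\<lambda>k. cinner (a k *\<^sub>C u k) (u j)) has_sum cinner x (u j)) UNIV"
    by (rule has_sum_cinner_left[OF assms(2)])
  moreover have "((\<lambda>k. cinner (a k *\<^sub>C u k) (u j)) has_sum a j) UNIV
      \<longleftrightarrow> ((\<lambda>k. a k) has_sum a j) {j}"
    by (rule has_sum_cong_neutral) (auto simp: cinner_scaleC_left assms(1))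
  ultimately show ?thesis
    using has_sum_finite[of "{j}" a] has_sum_unique by fastforce
qed

lemma Bessel_inequality:
  fixes u :: "'i \<Rightarrow> 'a::complex_inner_space"
  assumes "\<And>j k. cinner (u j) (u k) = (if j = k then 1 else 0)" "finite F"
  shows "(\<Sum>k\<in>F. (cmod (cinner x (u k)))\<^sup>2) \<le> (norm x)\<^sup>2"
proof -
  define p where "p = (\<Sum>k\<in>F. cinner x (u k) *\<^sub>C u k)"
  have "cinner x p = (\<Sum>k\<in>F. complex_of_real ((cmod (cinner x (u k)))\<^sup>2))"
    unfolding p_def cinner.sum_right cinner_scaleC_right complex_norm_square by (simp add: mult.commute)
  then have "Re (cinner x p) = (\<Sum>k\<in>F. (cmod (cinner x (u k)))\<^sup>2)"
    by (simp flip: of_real_sum of_real_power)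
  moreover have "(norm p)\<^sup>2 = (\<Sum>k\<in>F. (cmod (cinner x (u k)))\<^sup>2)"
    unfolding p_def by (rule norm_sum_orthonormal_sq[OF assms])
  moreover have "0 \<le> (norm (x - p))\<^sup>2" by simp
  ultimately show ?thesis
    unfolding norm_diff_sq by simp
qed

text \<open>By Pythagoras, distances between partial sums are governed by the scalar series of
  \<open>(cmod (a k))\<^sup>2\<close>, whose bounded partial sums make it convergent. The partial
  sums thus form a Cauchy filter.\<close>

lemma orthonormal_summable_on:
  fixes u :: "'i \<Rightarrow> 'a::complex_hilbert_space"
  assumes ortho: "\<And>j k. cinner (u j) (u k) = (if j = k then 1 else 0)"
    and le: "\<And>F. finite F \<Longrightarrow> (\<Sum>k\<in>F. (cmod (a k))\<^sup>2) \<le> C"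
  shows "(\<lambda>k. a k *\<^sub>C u k) summable_on UNIV"
proof -
  let ?f = "\<lambda>k. a k *\<^sub>C u k" and ?g = "\<lambda>k. (cmod (a k))\<^sup>2"
  have "?g summable_on UNIV"
    by (rule nonneg_bdd_above_summable_on) (auto intro!: bdd_aboveI[of _ C] le)
  then obtain S where S: "(?g has_sum S) UNIV"
    by (auto simp: summable_on_def)
  have le_S: "sum ?g F \<le> S" if "finite F" for F
    using has_sum_mono_neutral[OF has_sum_finite[OF that] S] by auto
  have "\<exists>P. eventually P (finite_subsets_at_top UNIV) \<and>
              (\<forall>F F'. P F \<and> P F' \<longrightarrow> dist (sum ?f F) (sum ?f F') < e)" if "e > 0" for e :: real
  proof (intro exI conjI allI impI)
    \<comment> \<open>Pythagoras computes the distance only for nested index sets. Both partial sums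
      are therefore compared with the one over \<open>F1 \<union> F2\<close>, each at distance below
      \<open>e/2\<close>.\<close>
    let ?P = "\<lambda>F. finite F \<and> S - (e/2)\<^sup>2 < sum ?g F"
    have "(sum ?g \<longlongrightarrow> S) (finite_subsets_at_top UNIV)"
      using S by (simp add: has_sum_def)
    then have "eventually (\<lambda>F. S - (e/2)\<^sup>2 < sum ?g F) (finite_subsets_at_top UNIV)"
      using that by (intro order_tendstoD(1)) auto
    then show "eventually ?P (finite_subsets_at_top UNIV)"
      by (auto simp: eventually_conj_iff eventually_finite_subsets_at_top_weakI)
    fix F1 F2 assume P: "?P F1 \<and> ?P F2"
    have "dist (sum ?f (F1 \<union> F2)) (sum ?f F) < e/2" if "F \<subseteq> F1 \<union> F2" "?P F" for F
    proof -
      have fin: "finite (F1 \<union> F2)" using P by simp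
      have "(dist (sum ?f (F1 \<union> F2)) (sum ?f F))\<^sup>2 = sum ?g (F1 \<union> F2 - F)"
        unfolding dist_norm sum_diff[OF fin that(1), symmetric] 
        using fin by (intro norm_sum_orthonormal_sq[OF ortho]) simp
      also have "\<dots> < (e/2)\<^sup>2"
        using le_S[OF fin] that(2) by (simp add: sum_diff[OF fin that(1)])
      finally show ?thesis
        by (rule power_less_imp_less_base) (use \<open>e > 0\<close> in simp)
    qed
    from this[of F1] this[of F2] P
    have "dist (sum ?f (F1 \<union> F2)) (sum ?f F1) < e/2" "dist (sum ?f (F1 \<union> F2)) (sum ?f F2) < e/2"
      by blast+
    then show "dist (sum ?f F1) (sum ?f F2) < e"
      using dist_triangle3[of "sum ?f F1" "sum ?f F2" "sum ?f (F1 \<union> F2)"] by linarith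
  qed
  then have "cauchy_filter (filtermap (sum ?f) (finite_subsets_at_top UNIV))"
    by (simp add: cauchy_filter_metric_filtermap)
  moreover have "complete (UNIV::'a set)"
    by (meson Cauchy_convergent UNIV_I complete_def convergent_def)
  ultimately obtain x where "(sum ?f \<longlongrightarrow> x) (finite_subsets_at_top UNIV)"
    using complete_uniform[where S=UNIV] by (force simp add: filterlim_def)
  then show ?thesis
    using summable_on_def has_sum_def by blast
qed

lemma dim_span_single: "x \<noteq> 0 \<Longrightarrow> complex_vector.dim (range (\<lambda>c. c *\<^sub>C x)) = 1" for x :: "'a::complex_inner_space"
  using complex_vector.dim_span_eq_card_independent[of "{x}"]
  by (simp add: complex_vector.span_singleton)

section \<open>Bounded symmetric operators\<close>

text \<open>The norm \<open>m\<close> of \<open>B\<close> on \<open>N\<close> is the modulus of an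
  approximate eigenvalue, one of \<open>m\<close> and \<open>- m\<close>. The vector
  \<open>x0\<close> makes \<open>m\<close> positive, so that \<open>1 / t\<close> is meaningful
  later; the subspace \<open>N\<close> allows restriction to the orthogonal complement of the
  eigenvectors.\<close>

lemma symmetric_norm_approx_eigenvalue:
  fixes B :: "'a::complex_inner_space \<Rightarrow> 'a"
  assumes B: "bounded_linear B"
    and sym: "\<And>x y. cinner (B x) y = cinner x (B y)"
    and N: "subspace N" and inv: "\<And>x. x \<in> N \<Longrightarrow> B x \<in> N"
    and x0: "x0 \<in> N" "B x0 \<noteq> 0"
  obtains t :: real where "t \<noteq> 0" "\<And>x. x \<in> N \<Longrightarrow> norm (B x) \<le> \<bar>t\<bar> * norm x"
    "\<And>e. e > 0 \<Longrightarrow> \<exists>x\<in>N. norm (B x - t *\<^sub>R x) < e * norm x"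
proof -
  interpret B: bounded_linear B by (rule B)
  define R where "R = (\<lambda>x. norm (B x) / norm x) ` (N - {0})"
  define m where "m = Sup R"
  have x0_nz: "x0 \<noteq> 0" using x0(2) B.zero by auto
  have "bdd_above R"
    unfolding R_def by (rule bdd_aboveI[of _ "onorm B"]) (use le_onorm[OF B] in auto)
  then have le_m: "norm (B x) \<le> m * norm x" if "x \<in> N" for x
    using cSup_upper[of "norm (B x) / norm x" R] that B.zero
    by (cases "x = 0") (auto simp: R_def m_def field_simps)
  have "0 < norm (B x0)" using x0 by simp
  also have "\<dots> \<le> m * norm x0" by (rule le_m[OF x0(1)])
  finally have m_pos: "m > 0" using x0_nz by (simp add: zero_less_mult_iff)
  txt \<open>If \<open>B - m\<close> and \<open>B + m\<close> were both bounded below on \<open>N\<close>, so would be \<open>B\<^sup>2 - m\<^sup>2\<close>; but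
    \<open>\<parallel>B\<^sup>2 x - m\<^sup>2 x\<parallel>\<^sup>2 \<le> m\<^sup>4 \<parallel>x\<parallel>\<^sup>2 - m\<^sup>2 \<parallel>B x\<parallel>\<^sup>2\<close> comes arbitrarily close to zero relative to \<open>\<parallel>x\<parallel>\<^sup>2\<close>.\<close>
  have "\<exists>t. \<bar>t\<bar> = m \<and> (\<forall>e>0. \<exists>x\<in>N. norm (B x - t *\<^sub>R x) < e * norm x)"
  proof (rule ccontr)
    assume neg: "\<not> ?thesis"
    have "\<exists>e>0. \<forall>x\<in>N. e * norm x \<le> norm (B x - t *\<^sub>R x)" if "\<bar>t\<bar> = m" for t
      using neg that unfolding not_less[symmetric] by blast
    from this[of m] this[of "- m"] m_pos obtain e1 e2 where
      e1: "e1 > 0" "\<And>x. x \<in> N \<Longrightarrow> e1 * norm x \<le> norm (B x - m *\<^sub>R x)" and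
      e2: "e2 > 0" "\<And>x. x \<in> N \<Longrightarrow> e2 * norm x \<le> norm (B x + m *\<^sub>R x)"
      by auto
    \<comment> \<open>The lower bounds multiply along (B - m)(B + m) = B^2 - m^2. Solving the
      resulting inequality for the squared norm of \<open>B x\<close> gives the factor
      \<open>q\<close>, which is smaller than \<open>m\<^sup>2\<close> and so contradicts the choice
      of \<open>m\<close> as a supremum.\<close>
    define q where "q = m\<^sup>2 - (e1 * e2)\<^sup>2 / m\<^sup>2"
    have sq: "(norm (B x))\<^sup>2 \<le> q * (norm x)\<^sup>2" if x: "x \<in> N" for x
    proof -
      define y where "y = B x + m *\<^sub>R x"
      have y: "y \<in> N"
        unfolding y_def by (intro subspace_add[OF N] subspace_mul[OF N] inv x)
      have "e1 * e2 * norm x \<le> e1 * norm y"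
        using e1(1) e2(2)[OF x] unfolding y_def by simp
      also have "\<dots> \<le> norm (B y - m *\<^sub>R y)" by (rule e1(2)[OF y])
      also have "B y - m *\<^sub>R y = B (B x) - m\<^sup>2 *\<^sub>R x"
        by (simp add: y_def B.add B.scaleR algebra_simps power2_eq_square)
      finally have "(e1 * e2 * norm x)\<^sup>2 \<le> (norm (B (B x) - m\<^sup>2 *\<^sub>R x))\<^sup>2"
        using e1(1) e2(1) by (intro power_mono) auto
      also have "\<dots> = (norm (B (B x)))\<^sup>2 - 2 * m\<^sup>2 * (norm (B x))\<^sup>2 + (m\<^sup>2 * norm x)\<^sup>2"
        unfolding norm_diff_sq by (simp add: cinner.scaleR_right sym[of "B x" x] cinner_self)
      also have "(norm (B (B x)))\<^sup>2 \<le> (m * norm (B x))\<^sup>2"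
        by (intro power_mono le_m inv x) auto
      finally have "m\<^sup>2 * (norm (B x))\<^sup>2 \<le> m^4 * (norm x)\<^sup>2 - (e1 * e2)\<^sup>2 * (norm x)\<^sup>2"
        by (simp add: power_mult_distrib algebra_simps)
      then show ?thesis
        using m_pos by (simp add: q_def field_simps power2_eq_square power4_eq_xxxx)
    qed
    have "0 < (norm (B x0))\<^sup>2" using x0 by simp
    also have "\<dots> \<le> q * (norm x0)\<^sup>2" by (rule sq[OF x0(1)])
    finally have q_pos: "q > 0" using x0_nz by (simp add: zero_less_mult_iff)
    have "norm (B x) \<le> sqrt q * norm x" if "x \<in> N" for x
      using real_le_rsqrt[OF sq[OF that]] by (simp add: real_sqrt_mult)
    then have "norm (B x) / norm x \<le> sqrt q" if "x \<in> N - {0}" for x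
      using that by (simp add: pos_divide_le_eq)
    then have "r \<le> sqrt q" if "r \<in> R" for r
      using that unfolding R_def by blast
    then have "m \<le> sqrt q"
      unfolding m_def using x0(1) x0_nz by (intro cSup_least) (auto simp: R_def)
    then have "m\<^sup>2 \<le> q"
      using m_pos q_pos by (metis power_mono less_imp_le real_sqrt_pow2)
    moreover have "(e1 * e2)\<^sup>2 / m\<^sup>2 > 0"
      using e1(1) e2(1) m_pos by simp
    ultimately show False
      by (simp add: q_def)
  qed
  then obtain t where t: "\<bar>t\<bar> = m" "\<And>e. e > 0 \<Longrightarrow> \<exists>x\<in>N. norm (B x - t *\<^sub>R x) < e * norm x"
    by blast
  show thesis
    by (rule that[of t]) (use t m_pos le_m in auto)
qed

text \<open>The two inequalities say that the spectrum of \<open>T\<close> lies in \<open>{0} \<union> [c, M]\<close>. Then the powers of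
  \<open>S = 1 - T / M\<close> converge geometrically to the projection onto the kernel of \<open>T\<close>.\<close>

lemma symmetric_gap_bounded_below:
  fixes T :: "'a::complex_hilbert_space \<Rightarrow> 'a"
  assumes T: "bounded_linear T"
    and sym: "\<And>x y. cinner (T x) y = cinner x (T y)"
    and pos: "M > 0" "c > 0"
    and up: "\<And>x. (norm (T x))\<^sup>2 \<le> M * Re (cinner (T x) x)"
    and gap: "\<And>x. c * Re (cinner (T x) x) \<le> (norm (T x))\<^sup>2"
  obtains \<delta> where "\<delta> > 0"
    "\<And>x. (\<And>k. T k = 0 \<Longrightarrow> cinner x k = 0) \<Longrightarrow> \<delta> * norm x \<le> norm (T x)"
proof -
  interpret T: bounded_linear T by (rule T)
  define S where "S = (\<lambda>x. x - (1/M) *\<^sub>R T x)"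
  \<comment> \<open>On [c, M] the function 1 - t/M is at most 1 - c/M. The estimate of
    \<open>S\<close> on the range of \<open>T\<close> is obtained for squared norms, hence the root;
    \<open>max 0\<close> covers the case c > M.\<close>
  define r where "r = sqrt (max 0 (1 - c/M))"
  have r: "0 \<le> r" "r < 1"
    using pos by (auto simp: r_def max_def)
  have T3: "c * (norm (T x))\<^sup>2 \<le> Re (cinner (T (T x)) (T x))" for x
  proof -
    \<comment> \<open>In spectral terms, t (1 - t/c)^2 >= 0 together with c t <= t^2 gives c t^2 <=
      t^3, which is the gap inequality on the range of \<open>T\<close>.\<close>
    define z where "z = x - (1/c) *\<^sub>R T x"
    have "0 \<le> M * Re (cinner (T z) z)"
      using up[of z] by (rule order_trans[OF zero_le_power2])
    then have "0 \<le> Re (cinner (T z) z)"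
      using pos by (simp add: zero_le_mult_iff)
    also have "cinner (T z) z = cinner (T x) x - (1/c) *\<^sub>R cinner (T x) (T x)
        - (1/c) *\<^sub>R cinner (T (T x)) x + (1/c) *\<^sub>R (1/c) *\<^sub>R cinner (T (T x)) (T x)"
      by (simp add: z_def T.diff T.scaleR cinner.diff_left cinner.diff_right
          cinner.scaleR_left cinner.scaleR_right scaleR_diff_right)
    also have "cinner (T (T x)) x = cinner (T x) (T x)" by (rule sym)
    finally have "0 \<le> Re (cinner (T x) x) - 2 / c * (norm (T x))\<^sup>2
        + Re (cinner (T (T x)) (T x)) / c\<^sup>2"
      by (simp add: cinner_self power2_eq_square)
    moreover have "Re (cinner (T x) x) \<le> (norm (T x))\<^sup>2 / c"
      using gap[of x] pos by (simp add: field_simps)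
    ultimately have "(norm (T x))\<^sup>2 / c \<le> Re (cinner (T (T x)) (T x)) / c\<^sup>2"
      by simp
    then show ?thesis
      using pos by (simp add: field_simps power2_eq_square)
  qed
  have TS: "norm (T (S x)) \<le> r * norm (T x)" for x
  proof -
    define z where "z = T x"
    have "(norm (T (S x)))\<^sup>2 = (norm (z - (1/M) *\<^sub>R T z))\<^sup>2"
      by (simp add: S_def z_def T.diff T.scaleR)
    also have "\<dots> = (norm z)\<^sup>2 - 2 / M * Re (cinner (T z) z) + (norm (T z))\<^sup>2 / M\<^sup>2"
      using pos unfolding norm_diff_sq
      by (simp add: cinner.scaleR_right sym power_mult_distrib power_divide)
    also have "(norm (T z))\<^sup>2 / M\<^sup>2 \<le> Re (cinner (T z) z) / M"
      using up[of z] pos by (simp add: field_simps power2_eq_square)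
    also have "(norm z)\<^sup>2 - 2 / M * Re (cinner (T z) z) + Re (cinner (T z) z) / M
        = (norm z)\<^sup>2 - Re (cinner (T z) z) / M"
      by (simp add: field_simps)
    also have "\<dots> \<le> (1 - c/M) * (norm z)\<^sup>2"
      using T3[of x] pos by (simp add: z_def field_simps)
    also have "\<dots> \<le> max 0 (1 - c/M) * (norm z)\<^sup>2"
      by (intro mult_right_mono) auto
    finally show ?thesis
      unfolding z_def r_def using real_le_rsqrt by (fastforce simp: real_sqrt_mult)
  qed
  have "M * (1 - r) * norm x \<le> norm (T x)" if ker: "\<And>k. T k = 0 \<Longrightarrow> cinner x k = 0" for x
  proof -
    define X where "X = (\<lambda>n. (S ^^ n) x)"
    have X_Suc: "X (Suc n) = S (X n)" and X_0: "X 0 = x" for n by (simp_all add: X_def)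
    have TX: "norm (T (X n)) \<le> r ^ n * norm (T x)" for n
    proof (induction n)
      case (Suc n)
      have "norm (T (X (Suc n))) \<le> r * norm (T (X n))"
        unfolding X_Suc by (rule TS)
      also have "\<dots> \<le> r * (r ^ n * norm (T x))"
        using Suc r(1) by (rule mult_left_mono)
      finally show ?case by simp
    qed (simp add: X_0)
    have geo: "(\<lambda>n. r ^ n * norm (T x) / M) sums (norm (T x) / (M * (1 - r)))"
      using sums_mult[OF geometric_sums[of r], of "norm (T x) / M"] r pos by (simp add: field_simps)
    have le_geo: "norm ((1/M) *\<^sub>R T (X n)) \<le> r ^ n * norm (T x) / M" for n
      using TX[of n] pos by (simp add: divide_right_mono)
    have summ: "summable (\<lambda>n. norm ((1/M) *\<^sub>R T (X n)))"
      by (rule summable_comparison_test[OF _ sums_summable[OF geo]]) (use le_geo in auto)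
    define y where "y = (\<Sum>n. (1/M) *\<^sub>R T (X n))"
    \<comment> \<open>Applying \<open>S\<close> subtracts \<open>T (X i) / M\<close> at each stage,
      so the iterates telescope. The subtracted terms are dominated by a geometric series, hence
      \<open>X\<close> converges to \<open>x - y\<close>, which lies in the kernel of
      \<open>T\<close>.\<close>
    define Y where "Y = (\<lambda>n. x - (\<Sum>i<n. (1/M) *\<^sub>R T (X i)))"
    have "X n = Y n" for n
      by (induction n) (simp_all add: X_0 X_Suc S_def Y_def)
    then have "X = Y" by (rule ext)
    moreover have "Y \<longlonglongrightarrow> x - y"
      unfolding Y_def y_def
      by (intro tendsto_diff tendsto_const summable_LIMSEQ summable_norm_cancel[OF summ])
    ultimately have X_lim: "X \<longlonglongrightarrow> x - y" by simp
    have "(\<lambda>n. T (X n)) \<longlonglongrightarrow> 0"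
    proof (rule Lim_null_comparison)
      show "eventually (\<lambda>n. norm (T (X n)) \<le> r ^ n * norm (T x)) sequentially"
        using TX by simp
      show "(\<lambda>n. r ^ n * norm (T x)) \<longlonglongrightarrow> 0"
        using r by (intro tendsto_mult_left_zero LIMSEQ_power_zero) simp
    qed
    moreover have "(\<lambda>n. T (X n)) \<longlonglongrightarrow> T (x - y)"
      by (rule T.tendsto[OF X_lim])
    ultimately have T_lim: "T (x - y) = 0" using LIMSEQ_unique by blast
    \<comment> \<open>\<open>S\<close> preserves orthogonality to kernel vectors of
      \<open>T\<close>. The limit \<open>x - y\<close> is such a kernel vector and so is orthogonal
      to itself; hence \<open>x = y\<close>, and the geometric series bounds the norm of
      \<open>x\<close>.\<close>
    have "cinner (X n) (x - y) = 0" for n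
    proof (induction n)
      case (Suc n)
      then show ?case
        by (simp add: X_Suc S_def cinner.diff_left[of "X n"] cinner.scaleR_left sym T_lim cinner.zero_right)
    qed (simp add: X_0 ker T_lim)
    moreover have "(\<lambda>n. cinner (X n) (x - y)) \<longlonglongrightarrow> cinner (x - y) (x - y)"
      by (intro cinner.tendsto X_lim tendsto_const)
    ultimately have "cinner (x - y) (x - y) = 0"
      using LIMSEQ_unique[OF _ tendsto_const] by fastforce
    then have "x = y" by (simp add: cinner_self_eq_0_iff)
    then have "norm x \<le> (\<Sum>n. norm ((1/M) *\<^sub>R T (X n)))"
      unfolding y_def using summable_norm[OF summ] by metis
    also have "\<dots> \<le> norm (T x) / (M * (1 - r))"
      unfolding sums_unique[OF geo] by (intro suminf_le le_geo summ sums_summable[OF geo])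
    finally show ?thesis
      using r pos by (simp add: field_simps)
  qed
  then show thesis
    using that[of "M * (1 - r)"] r pos by simp
qed

section \<open>Unbounded operators and rank-one perturbations\<close>

lemma linear_operator_diff:
  assumes "linear_operator D A" "x \<in> D" "y \<in> D"
  shows "x - y \<in> D \<and> A (x - y) = A x - A y"
proof -
  have "(- 1) *\<^sub>C y \<in> D" "A ((- 1) *\<^sub>C y) = (- 1) *\<^sub>C A y"
    using assms unfolding linear_operator_def complex_vector.subspace_def by blast+
  then have "x + (- 1) *\<^sub>C y \<in> D" "A (x + (- 1) *\<^sub>C y) = A x + (- 1) *\<^sub>C A y"
    using assms unfolding linear_operator_def complex_vector.subspace_def by metis+
  then show ?thesis by simp
qed

text \<open>The norm bound is asked of one preimage of each \<open>f\<close>; injectivity makes it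
  the bound for every \<open>x\<close> in the domain.\<close>

lemma resolvent_setI:
  assumes lin: "linear_operator D A"
    and inj: "\<And>x. x \<in> D \<Longrightarrow> A x - z *\<^sub>C x = 0 \<Longrightarrow> x = 0"
    and surj: "\<And>f. \<exists>x\<in>D. A x - z *\<^sub>C x = f \<and> norm x \<le> C * norm f"
  shows "z \<in> resolvent_set D A"
proof -
  have inj': "x = y" if "x \<in> D" "y \<in> D" "A x - z *\<^sub>C x = A y - z *\<^sub>C y" for x y
  proof -
    have "A (x - y) - z *\<^sub>C (x - y) = 0"
      unfolding conjunct2[OF linear_operator_diff[OF lin that(1,2)]]
        complex_vector.scale_right_diff_distrib
      using that(3) by (simp add: algebra_simps)
    then have "x - y = 0"
      using linear_operator_diff[OF lin that(1,2)] inj by blast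
    then show ?thesis by simp
  qed
  have "bij_betw (\<lambda>x. A x - z *\<^sub>C x) D UNIV"
  proof (rule bij_betwI')
    show "\<exists>x\<in>D. f = A x - z *\<^sub>C x" for f using surj[of f] by metis
  qed (use inj' in auto)
  moreover have "norm x \<le> C * norm (A x - z *\<^sub>C x)" if x: "x \<in> D" for x
    using surj[of "A x - z *\<^sub>C x"] inj'[OF _ x] by metis
  ultimately show ?thesis by (auto simp: resolvent_set_def)
qed

lemma eigenvalue_in_spectrum:
  assumes lin: "linear_operator D A" and x: "x \<in> eigenspace D A z" "x \<noteq> 0"
  shows "z \<in> spectrum D A"
proof -
  have xD: "x \<in> D" "A x = z *\<^sub>C x" using x by (auto simp: eigenspace_def)
  have "0 \<in> D" "A 0 = 0"
    using linear_operator_diff[OF lin xD(1) xD(1)] by auto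
  then have "\<not> inj_on (\<lambda>x. A x - z *\<^sub>C x) D"
    using xD x(2) unfolding inj_on_def by force
  then show ?thesis
    by (auto simp: spectrum_def resolvent_set_def bij_betw_def)
qed

lemma linear_operator_rank_one_perturbation:
  assumes "linear_operator D A"
  shows "linear_operator D (rank_one_perturbation A mu v)"
  using assms unfolding linear_operator_def rank_one_perturbation_def
  by (auto simp: cinner_add_left cinner_scaleC_left scaleC_add_left scaleC_add_right scaleC_scaleC algebra_simps)

section \<open>Selfadjoint operators with simple discrete spectrum\<close>

locale simple_discrete_operator =
  fixes D :: "'a::complex_hilbert_space set"
    and A :: "'a \<Rightarrow> 'a"
    and lam :: "int \<Rightarrow> real"
    and u :: "int \<Rightarrow> 'a"
  assumes selfadj: "selfadjoint D A"
    and discrete: "simple_discrete_spectrum D A lam"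
    and eigen: "orthonormal_eigenvectors D A lam u"
begin

lemma linear: "linear_operator D A"
  using selfadj by (simp add: selfadjoint_def)

lemma dom: "0 \<in> D" "x \<in> D \<Longrightarrow> y \<in> D \<Longrightarrow> x + y \<in> D" "x \<in> D \<Longrightarrow> c *\<^sub>C x \<in> D"
    "x \<in> D \<Longrightarrow> r *\<^sub>R x \<in> D"
  using linear by (auto simp: linear_operator_def complex_vector.subspace_def scaleR_scaleC)

lemma op: "x \<in> D \<Longrightarrow> y \<in> D \<Longrightarrow> A (x + y) = A x + A y" "x \<in> D \<Longrightarrow> A (c *\<^sub>C x) = c *\<^sub>C A x"
    "x \<in> D \<Longrightarrow> A (r *\<^sub>R x) = r *\<^sub>R A x"
  using linear by (auto simp: linear_operator_def scaleR_scaleC)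

lemma op_diff: "x \<in> D \<Longrightarrow> y \<in> D \<Longrightarrow> x - y \<in> D" "x \<in> D \<Longrightarrow> y \<in> D \<Longrightarrow> A (x - y) = A x - A y"
  using linear_operator_diff[OF linear] by auto

lemma op_sum: "finite F \<Longrightarrow> (\<And>k. k \<in> F \<Longrightarrow> f k \<in> D) \<Longrightarrow> (\<Sum>k\<in>F. f k) \<in> D \<and> A (\<Sum>k\<in>F. f k) = (\<Sum>k\<in>F. A (f k))"
proof (induction F rule: finite_induct)
  case empty
  show ?case using op_diff(2)[of 0 0] dom(1) by simp
qed (simp add: dom op)

lemma adjoint: "adjoint_graph D A = op_graph D A"
  using selfadj by (simp add: selfadjoint_def)

lemma symmetric: "x \<in> D \<Longrightarrow> y \<in> D \<Longrightarrow> cinner (A x) y = cinner x (A y)"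
  using adjoint by (auto simp: adjoint_graph_def op_graph_def)

text \<open>An adjoint graph is closed because the inner product is continuous, and selfadjointness
  identifies it with the graph of \<open>A\<close>. An arbitrary filter is allowed because the
  limits to come run over finite index sets.\<close>

lemma closed_op:
  assumes "(X \<longlongrightarrow> x) F" "((\<lambda>n. A (X n)) \<longlongrightarrow> y) F" "F \<noteq> bot" "eventually (\<lambda>n. X n \<in> D) F"
  shows "x \<in> D \<and> A x = y"
proof -
  have "cinner (A w) x = cinner w y" if "w \<in> D" for w
  proof (rule tendsto_unique[OF assms(3)])
    show "((\<lambda>n. cinner (A w) (X n)) \<longlongrightarrow> cinner (A w) x) F"
      by (intro cinner.tendsto tendsto_const assms)
    have "((\<lambda>n. cinner w (A (X n))) \<longlongrightarrow> cinner w y) F"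
      by (intro cinner.tendsto tendsto_const assms)
    then show "((\<lambda>n. cinner (A w) (X n)) \<longlongrightarrow> cinner w y) F"
      by (rule Lim_transform_eventually)
        (use assms(4) that symmetric in \<open>auto elim!: eventually_mono\<close>)
  qed
  then have "(x, y) \<in> adjoint_graph D A" by (simp add: adjoint_graph_def)
  then show ?thesis unfolding adjoint by (auto simp: op_graph_def)
qed

lemma u_dom: "u k \<in> D" and A_u: "A (u k) = complex_of_real (lam k) *\<^sub>C u k"
    and ortho: "cinner (u j) (u k) = (if j = k then 1 else 0)"
  using eigen by (auto simp: orthonormal_eigenvectors_def)

lemma u_nonzero: "u k \<noteq> 0"
  using ortho[of k k] by (auto simp: cinner.zero_left)

lemma inj_lam: "lam j = lam k \<longleftrightarrow> j = k"
  using discrete by (auto simp: simple_discrete_spectrum_def strict_mono_eq)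

lemma spectrum_eq: "spectrum D A = range (\<lambda>k. complex_of_real (lam k))"
  using discrete by (simp add: simple_discrete_spectrum_def)

lemma coeff_A: "x \<in> D \<Longrightarrow> cinner (A x) (u k) = complex_of_real (lam k) * cinner x (u k)"
  by (simp add: symmetric u_dom A_u cinner_scaleC_right)

lemma coeff_shift:
  "x \<in> D \<Longrightarrow> cinner (A x - z *\<^sub>C x) (u k) = (complex_of_real (lam k) - z) * cinner x (u k)"
  by (simp add: cinner.diff_left coeff_A cinner_scaleC_left algebra_simps)

lemma eigenvector_eq:
  assumes "x \<in> D" "A x = complex_of_real (lam k) *\<^sub>C x"
  shows "x = cinner x (u k) *\<^sub>C u k"
proof -
  let ?E = "eigenspace D A (complex_of_real (lam k))"
  obtain B where B: "B \<subseteq> ?E" "?E \<subseteq> complex_vector.span B" "card B = complex_vector.dim ?E"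
    using complex_vector.basis_exists[of ?E] by metis
  then have "card B = 1"
    using discrete by (auto simp: simple_discrete_spectrum_def eigenvalue_multiplicity_def)
  then obtain b where "B = {b}" by (auto simp: card_1_singleton_iff)
  with B have E: "?E \<subseteq> range (\<lambda>c. c *\<^sub>C b)" by (simp add: complex_vector.span_singleton)
  have "x \<in> ?E" "u k \<in> ?E" using assms by (auto simp: eigenspace_def u_dom A_u)
  with E obtain c d where c: "x = c *\<^sub>C b" and d: "u k = d *\<^sub>C b" by blast
  with u_nonzero[of k] have "d \<noteq> 0" by auto
  then have "x = (c / d) *\<^sub>C u k" by (simp add: c d scaleC_scaleC)
  then show ?thesis by (metis cinner_scaleC_left mult.right_neutral ortho)
qed

section \<open>The resolvent at a real point outside the spectrum, and its norm\<close>

lemma real_resolvent: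
  assumes "w \<notin> range lam"
  obtains B where "bounded_linear B" "\<And>x y. cinner (B x) y = cinner x (B y)"
    "\<And>y. B y \<in> D" "\<And>y. A (B y) - w *\<^sub>R B y = y" "\<And>x. x \<in> D \<Longrightarrow> B (A x - w *\<^sub>R x) = x"
proof -
  have "complex_of_real w \<notin> spectrum D A"
    using assms unfolding spectrum_eq by auto
  then have "complex_of_real w \<in> resolvent_set D A"
    by (simp add: spectrum_def)
  then obtain C where bij: "bij_betw (\<lambda>x. A x - w *\<^sub>R x) D UNIV"
    and C: "\<And>x. x \<in> D \<Longrightarrow> norm x \<le> C * norm (A x - w *\<^sub>R x)"
    by (auto simp: resolvent_set_def scaleR_scaleC)
  define B where "B = the_inv_into D (\<lambda>x. A x - w *\<^sub>R x)"
  have B_D: "B y \<in> D" for y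
    using the_inv_into_into[OF bij_betw_imp_inj_on[OF bij], of y D] bij
    by (auto simp: B_def bij_betw_def)
  have B_r: "A (B y) - w *\<^sub>R B y = y" for y
    using f_the_inv_into_f_bij_betw[OF bij] by (simp add: B_def)
  have B_l: "B (A x - w *\<^sub>R x) = x" if "x \<in> D" for x
    using the_inv_into_f_f[OF bij_betw_imp_inj_on[OF bij] that] by (simp add: B_def)
  have "bounded_linear B"
  proof (rule bounded_linear_intro[where K = C])
    fix x y :: 'a and r :: real
    have "A (B x + B y) - w *\<^sub>R (B x + B y) = (A (B x) - w *\<^sub>R B x) + (A (B y) - w *\<^sub>R B y)"
      by (simp add: op B_D algebra_simps)
    then show "B (x + y) = B x + B y"
      using B_l[OF dom(2)[OF B_D[of x] B_D[of y]]] by (simp add: B_r)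
    have "A (r *\<^sub>R B x) - w *\<^sub>R (r *\<^sub>R B x) = r *\<^sub>R (A (B x) - w *\<^sub>R B x)"
      by (simp add: op B_D algebra_simps)
    then show "B (r *\<^sub>R x) = r *\<^sub>R B x"
      using B_l[OF dom(4)[OF B_D[of x]], of r] by (simp add: B_r)
    show "norm (B x) \<le> norm x * C"
      using C[OF B_D[of x]] by (simp add: B_r mult.commute)
  qed
  moreover have "cinner (B x) y = cinner x (B y)" for x y
  proof -
    have "cinner (B x) y = cinner (B x) (A (B y) - w *\<^sub>R B y)" by (simp add: B_r)
    also have "\<dots> = cinner (A (B x) - w *\<^sub>R B x) (B y)"
      by (simp add: cinner.diff_left cinner.diff_right cinner.scaleR_left cinner.scaleR_right
          symmetric B_D)
    finally show ?thesis by (simp add: B_r)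
  qed
  ultimately show thesis using that B_D B_r B_l by blast
qed

text \<open>An approximate eigenvalue \<open>t\<close> of the resolvent on \<open>N\<close>
  corresponds to the approximate eigenvalue \<open>w + 1 / t\<close> of \<open>A\<close>. This
  number lies in the spectrum and is therefore some \<open>lam j\<close>.\<close>

lemma resolvent_norm_attained:
  assumes w: "w \<notin> range lam" and N: "subspace N"
    and inv: "\<And>x. x \<in> D \<Longrightarrow> A x - w *\<^sub>R x \<in> N \<Longrightarrow> x \<in> N"
    and y0: "y0 \<in> N" "y0 \<noteq> 0"
  obtains t j where "t \<noteq> 0" "lam j = w + 1 / t"
    "\<And>x. x \<in> D \<Longrightarrow> A x - w *\<^sub>R x \<in> N \<Longrightarrow> norm x \<le> \<bar>t\<bar> * norm (A x - w *\<^sub>R x)"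
    "\<And>e. e > 0 \<Longrightarrow> \<exists>x\<in>D \<inter> N. norm (A x - lam j *\<^sub>R x) < e * norm x"
proof -
  obtain B where B: "bounded_linear B" "\<And>x y. cinner (B x) y = cinner x (B y)"
    and B_D: "\<And>y. B y \<in> D" and B_r: "\<And>y. A (B y) - w *\<^sub>R B y = y"
    and B_l: "\<And>x. x \<in> D \<Longrightarrow> B (A x - w *\<^sub>R x) = x"
    using real_resolvent[OF w] by metis
  interpret B: bounded_linear B by (rule B)
  have B_N: "B x \<in> N" if "x \<in> N" for x
    by (rule inv) (simp_all add: B_D B_r that)
  have B_nz: "B y \<noteq> 0" if "y \<noteq> 0" for y
    using B_r[of y] op(3)[OF dom(1), of 0] that by auto
  obtain t where t: "t \<noteq> 0" "\<And>x. x \<in> N \<Longrightarrow> norm (B x) \<le> \<bar>t\<bar> * norm x"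
    "\<And>e. e > 0 \<Longrightarrow> \<exists>x\<in>N. norm (B x - t *\<^sub>R x) < e * norm x"
    using symmetric_norm_approx_eigenvalue[OF B N B_N y0(1) B_nz[OF y0(2)]] by metis
  have approx: "\<exists>x\<in>D \<inter> N. norm (A x - (w + 1 / t) *\<^sub>R x) < e * norm x" if "e > 0" for e
  proof -
    \<comment> \<open>The first bound keeps the norm of \<open>B y\<close> at least half of |t|
      times that of \<open>y\<close>, so that \<open>B y\<close> is usable as an approximate
      eigenvector of \<open>A\<close>; the second makes its relative error less than
      \<open>e\<close>.\<close>
    define e' where "e' = min (\<bar>t\<bar> / 2) (e * t\<^sup>2 / 2)"
    have "e' > 0" using that t by (simp add: e'_def)
    from t(3)[OF this] obtain y where y: "y \<in> N" "norm (B y - t *\<^sub>R y) < e' * norm y" by blast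
    then have "y \<noteq> 0" by (auto simp: B.zero)
    have "\<bar>t\<bar> * norm y \<le> norm (B y) + norm (B y - t *\<^sub>R y)"
      using norm_triangle_ineq4[of "B y" "B y - t *\<^sub>R y"] by simp
    also have "\<dots> \<le> norm (B y) + \<bar>t\<bar> / 2 * norm y"
    proof -
      have "e' * norm y \<le> \<bar>t\<bar> / 2 * norm y" by (intro mult_right_mono) (auto simp: e'_def)
      with y(2) show ?thesis by simp
    qed
    finally have le: "\<bar>t\<bar> * norm y \<le> 2 * norm (B y)" by simp
    have "A (B y) - (w + 1 / t) *\<^sub>R B y = y - (1 / t) *\<^sub>R B y"
      using B_r[of y] by (simp add: algebra_simps)
    also have "\<dots> = - (1 / t) *\<^sub>R (B y - t *\<^sub>R y)"
      using t(1) by (simp add: algebra_simps)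
    finally have "norm (A (B y) - (w + 1 / t) *\<^sub>R B y) = norm (B y - t *\<^sub>R y) / \<bar>t\<bar>"
      by (simp only: norm_scaleR) simp
    also have "\<dots> < e' * norm y / \<bar>t\<bar>"
      using y(2) t(1) by (simp add: divide_strict_right_mono)
    also have "\<dots> \<le> e * t\<^sup>2 / 2 * norm y / \<bar>t\<bar>"
      by (intro divide_right_mono mult_right_mono) (auto simp: e'_def)
    also have "\<dots> = e / 2 * (\<bar>t\<bar> * norm y)"
      using t(1) by (cases "t > 0") (simp_all add: power2_eq_square field_simps)
    also have "\<dots> \<le> e / 2 * (2 * norm (B y))"
      using le that by (intro mult_left_mono) auto
    finally show ?thesis using B_D B_N[OF y(1)] by auto
  qed
  have "complex_of_real (w + 1 / t) \<notin> resolvent_set D A"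
  proof
    assume "complex_of_real (w + 1 / t) \<in> resolvent_set D A"
    then obtain C where C: "\<And>x. x \<in> D \<Longrightarrow> norm x \<le> C * norm (A x - (w + 1 / t) *\<^sub>R x)"
      unfolding resolvent_set_def scaleR_scaleC by auto
    \<comment> \<open>The constant \<open>C\<close> may be zero or negative, hence the denominator
      \<open>\<bar>C\<bar> + 1\<close>.\<close>
    obtain x where x: "x \<in> D" "norm (A x - (w + 1 / t) *\<^sub>R x) < 1 / (\<bar>C\<bar> + 1) * norm x"
      using approx[of "1 / (\<bar>C\<bar> + 1)"] by (auto simp: add_nonneg_pos)
    have "norm x \<le> \<bar>C\<bar> * norm (A x - (w + 1 / t) *\<^sub>R x)"
      using C[OF x(1)] by (rule order_trans) (intro mult_right_mono, auto)
    also have "\<dots> \<le> (\<bar>C\<bar> + 1) * norm (A x - (w + 1 / t) *\<^sub>R x)"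
      by (intro mult_right_mono) auto
    also have "\<dots> < norm x"
      using x(2) by (simp add: field_simps)
    finally show False by simp
  qed
  then obtain j where j: "lam j = w + 1 / t"
    using spectrum_eq unfolding spectrum_def by (metis ComplI of_real_eq_iff rangeE)
  show thesis
  proof (rule that[OF t(1) j])
    fix x assume "x \<in> D" "A x - w *\<^sub>R x \<in> N"
    then show "norm x \<le> \<bar>t\<bar> * norm (A x - w *\<^sub>R x)"
      using t(2)[of "A x - w *\<^sub>R x"] by (simp add: B_l)
  qed (use approx j in simp)
qed

text \<open>With \<open>N = UNIV\<close>, the attained norm |t| of the resolvent is the reciprocal
  of the distance from \<open>w\<close> to some eigenvalue, and that distance is at least
  \<open>d\<close>.\<close>

lemma resolvent_norm_le:
  assumes d: "d > 0" "\<And>j. d \<le> \<bar>lam j - w\<bar>" and x: "x \<in> D"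
  shows "d * norm x \<le> norm (A x - w *\<^sub>R x)"
proof -
  have "w \<notin> range lam" using d by (metis abs_zero cancel_comm_monoid_add_class.diff_cancel not_le rangeE)
  then obtain t j where t: "t \<noteq> 0" "lam j = w + 1 / t" "norm x \<le> \<bar>t\<bar> * norm (A x - w *\<^sub>R x)"
    by (rule resolvent_norm_attained[of w UNIV "u 0"]) (use x u_nonzero in auto)
  have "d \<le> 1 / \<bar>t\<bar>" using d(2)[of j] t(2) by simp
  then have "d * norm x \<le> 1 / \<bar>t\<bar> * (\<bar>t\<bar> * norm (A x - w *\<^sub>R x))"
    using t(3) d(1) by (intro mult_mono) auto
  then show ?thesis using t(1) by simp
qed

section \<open>Isolation of the eigenvalues and completeness of the eigenvectors\<close>

lemma spectral_gap:
  obtains d where "d > 0" "\<And>k. complex_of_real (lam k) \<noteq> z \<Longrightarrow> d \<le> cmod (complex_of_real (lam k) - z)"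
proof -
  have "\<not> Re z islimpt range lam"
    using discrete by (simp add: simple_discrete_spectrum_def)
  then obtain e where e: "e > 0" "\<And>k. lam k \<noteq> Re z \<Longrightarrow> e \<le> \<bar>lam k - Re z\<bar>"
    unfolding islimpt_approachable_real by (auto simp: not_less)
  \<comment> \<open>Off the real axis the imaginary part already separates \<open>z\<close> from all
    eigenvalues; on it, the absence of a limit point does.\<close>
  define d where "d = (if Im z = 0 then e else \<bar>Im z\<bar>)"
  show thesis
  proof (rule that)
    show "d > 0" using e by (simp add: d_def)
    fix k assume k: "complex_of_real (lam k) \<noteq> z"
    show "d \<le> cmod (complex_of_real (lam k) - z)"
    proof (cases "Im z = 0")
      case True
      then show ?thesis
        using e(2)[of k] k abs_Re_le_cmod[of "complex_of_real (lam k) - z"]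
        by (auto simp: d_def complex_eq_iff)
    next
      case False
      then show ?thesis
        using abs_Im_le_cmod[of "complex_of_real (lam k) - z"] by (simp add: d_def)
    qed
  qed
qed

text \<open>The gap bound for bounded operators is applied to \<open>T = (A - \<lambda>\<^sub>k) (A - w)\<inverse>\<close> with \<open>w = \<lambda>\<^sub>k + d / 2\<close>, where \<open>d\<close>
  is the distance from \<open>\<lambda>\<^sub>k\<close> to the other eigenvalues.\<close>

lemma eigenvalue_gap_bounded_below:
  obtains \<delta> where "\<delta> > 0"
    "\<And>x. x \<in> D \<Longrightarrow> cinner x (u k) = 0 \<Longrightarrow> \<delta> * norm x \<le> norm (A x - lam k *\<^sub>R x)"
proof -
  obtain d where d: "d > 0" "\<And>j. lam j \<noteq> lam k \<Longrightarrow> d \<le> \<bar>lam j - lam k\<bar>"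
    using spectral_gap[of "complex_of_real (lam k)"]
    by (metis norm_of_real of_real_diff of_real_eq_iff)
  define A' where "A' = (\<lambda>x. A x - lam k *\<^sub>R x)"
  have half: "d / 2 \<le> \<bar>lam j - (lam k + s * (d / 2))\<bar>" if "\<bar>s\<bar> = 1" for j s
    using d(1) d(2)[of j] that by (cases "lam j = lam k") (auto simp: abs_if split: if_splits)
  \<comment> \<open>The points at distance \<open>d / 2\<close> from \<open>lam k\<close> on either
    side have resolvent norm at most 2/d. Squaring that estimate says that \<open>A'\<close> has no
    spectrum between 0 and \<open>s * d\<close>; both signs of \<open>s\<close> are used.\<close>
  have A'_bound: "s * d * Re (cinner (A' x) x) \<le> (norm (A' x))\<^sup>2" if "\<bar>s\<bar> = 1" "x \<in> D" for s x
  proof -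
    have "d / 2 * norm x \<le> norm (A x - (lam k + s * (d / 2)) *\<^sub>R x)"
      using resolvent_norm_le[OF _ half] d(1) that by simp
    also have "A x - (lam k + s * (d / 2)) *\<^sub>R x = A' x - (s * (d / 2)) *\<^sub>R x"
      by (simp add: A'_def algebra_simps)
    finally have "(d / 2 * norm x)\<^sup>2 \<le> (norm (A' x - (s * (d / 2)) *\<^sub>R x))\<^sup>2"
      using d(1) by (intro power_mono) auto
    also have "\<dots> = (norm (A' x))\<^sup>2 - s * d * Re (cinner (A' x) x) + (\<bar>s\<bar> * (d / 2) * norm x)\<^sup>2"
      unfolding norm_diff_sq using d(1) by (simp add: cinner.scaleR_right abs_mult)
    finally show ?thesis using that by simp
  qed
  define w where "w = lam k + d / 2"
  have "w \<notin> range lam"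
  proof
    assume "w \<in> range lam"
    then obtain j where "w = lam j" by blast
    then show False using half[of 1 j] d(1) by (simp add: w_def)
  qed
  then obtain B where B: "bounded_linear B" "\<And>x y. cinner (B x) y = cinner x (B y)"
    and B_D: "\<And>y. B y \<in> D" and B_r: "\<And>y. A (B y) - w *\<^sub>R B y = y"
    and B_l: "\<And>x. x \<in> D \<Longrightarrow> B (A x - w *\<^sub>R x) = x"
    using real_resolvent by metis
  define T where "T = (\<lambda>y. y + (d / 2) *\<^sub>R B y)"
  have T_eq: "T y = A' (B y)" for y
    using B_r[of y] by (simp add: T_def A'_def w_def algebra_simps)
  have bl: "bounded_linear T"
    unfolding T_def
    by (intro bounded_linear_add bounded_linear_ident bounded_linear_scaleR_right[THEN bounded_linear_compose] B)
  have sym: "cinner (T x) y = cinner x (T y)" for x y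
    by (simp add: T_def cinner.add_left cinner.add_right cinner.scaleR_left cinner.scaleR_right B(2))
  have Ty: "Re (cinner (T y) y) = (norm (T y))\<^sup>2 - d / 2 * Re (cinner (A' (B y)) (B y))" for y
  proof -
    have "cinner (T y) y = cinner (T y) (T y - (d / 2) *\<^sub>R B y)" by (simp add: T_def)
    then show ?thesis
      by (simp add: cinner.diff_right cinner.scaleR_right cinner_self T_eq)
  qed
  \<comment> \<open>A spectral value a of \<open>A'\<close> becomes a / (a - d/2) for
    \<open>T\<close>. It is 0 at a = 0 and, for |a| >= d, lies between 2/3 (at a = -d) and 2 (at a =
    d).\<close>
  have up: "(norm (T y))\<^sup>2 \<le> 2 * Re (cinner (T y) y)" for y
    using A'_bound[of 1 "B y"] B_D unfolding Ty by (simp add: T_eq)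
  have gap: "2 / 3 * Re (cinner (T y) y) \<le> (norm (T y))\<^sup>2" for y
    using A'_bound[of "- 1" "B y"] B_D unfolding Ty by (simp add: T_eq)
  obtain \<delta> where \<delta>: "\<delta> > 0"
    "\<And>x. (\<And>k. T k = 0 \<Longrightarrow> cinner x k = 0) \<Longrightarrow> \<delta> * norm x \<le> norm (T x)"
    using symmetric_gap_bounded_below[OF bl sym _ _ up gap] by auto
  show thesis
  proof (rule that)
    show "\<delta> * (d / 2) > 0" using \<delta>(1) d(1) by simp
    fix x assume x: "x \<in> D" "cinner x (u k) = 0"
    define y where "y = A x - w *\<^sub>R x"
    have By: "B y = x" by (simp add: y_def B_l x)
    have yk: "cinner y (u k) = 0"
      using coeff_shift[OF x(1), of "complex_of_real w" k] x(2) by (simp add: y_def scaleR_scaleC)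
    \<comment> \<open>If \<open>T p = 0\<close>, then \<open>B p\<close> is a multiple of
      \<open>u k\<close>, and \<open>p\<close> is a multiple of \<open>B p\<close>. So orthogonality
      of \<open>y\<close> to \<open>u k\<close> is orthogonality to the whole kernel of
      \<open>T\<close>.\<close>
    have "cinner y p = 0" if "T p = 0" for p
    proof -
      have "A (B p) = complex_of_real (lam k) *\<^sub>C B p"
        using that unfolding T_eq A'_def by (simp add: scaleR_scaleC)
      then have "B p = cinner (B p) (u k) *\<^sub>C u k" by (rule eigenvector_eq[OF B_D])
      moreover have "p = (- (d / 2)) *\<^sub>R B p"
        using that by (simp add: T_def eq_neg_iff_add_eq_0)
      ultimately show ?thesis
        by (metis cinner.scaleR_right cinner_scaleC_right mult_zero_right scaleR_zero_right yk)
    qed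
    then have "\<delta> * norm y \<le> norm (T y)" by (rule \<delta>(2))
    moreover have "d / 2 * norm x \<le> norm y"
      unfolding y_def by (rule resolvent_norm_le[OF _ _ x(1)]) (use half[of 1] d(1) in \<open>auto simp: w_def\<close>)
    then have "\<delta> * (d / 2 * norm x) \<le> \<delta> * norm y"
      using \<delta>(1) by (intro mult_left_mono) auto
    ultimately show "\<delta> * (d / 2) * norm x \<le> norm (A x - lam k *\<^sub>R x)"
      by (simp add: T_eq By A'_def mult.assoc)
  qed
qed

lemma eigenvectors_complete:
  assumes y: "\<And>k. cinner y (u k) = 0"
  shows "y = 0"
proof (rule ccontr)
  assume nz: "y \<noteq> 0"
  define N where "N = {y. \<forall>k. cinner y (u k) = 0}"
  \<comment> \<open>A point strictly between two consecutive eigenvalues is outside the spectrum,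
    and being real it has a symmetric resolvent.\<close>
  define w where "w = (lam 0 + lam 1) / 2"
  have "strict_mono lam" using discrete by (simp add: simple_discrete_spectrum_def)
  then have mono: "lam i < lam j \<longleftrightarrow> i < j" for i j by (rule strict_mono_less)
  have w: "lam 0 < w" "w < lam 1" using mono[of 0 1] by (simp_all add: w_def)
  have w_nin: "w \<notin> range lam"
  proof
    assume "w \<in> range lam"
    then obtain j where "w = lam j" by blast
    with w have "0 < j" "j < 1" by (simp_all add: mono)
    then show False by simp
  qed
  have N: "subspace N"
    unfolding N_def by (rule subspaceI) (simp_all add: cinner.zero_left cinner_add_left cinner.scaleR_left)
  have inv: "x \<in> N" if "x \<in> D" "A x - w *\<^sub>R x \<in> N" for x
  proof -
    have "(complex_of_real (lam k) - complex_of_real w) * cinner x (u k) = 0" for k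
      using coeff_shift[OF that(1), of "complex_of_real w" k] that(2) by (simp add: N_def scaleR_scaleC)
    with w_nin show ?thesis by (force simp: N_def)
  qed
  have yN: "y \<in> N" using y by (simp add: N_def)
  obtain j where j: "\<And>e. e > 0 \<Longrightarrow> \<exists>x\<in>D \<inter> N. norm (A x - lam j *\<^sub>R x) < e * norm x"
    using resolvent_norm_attained[OF w_nin N inv yN nz] by metis
  obtain \<delta> where "\<delta> > 0"
    "\<And>x. x \<in> D \<Longrightarrow> cinner x (u j) = 0 \<Longrightarrow> \<delta> * norm x \<le> norm (A x - lam j *\<^sub>R x)"
    using eigenvalue_gap_bounded_below[of j] by metis
  with j[of \<delta>] show False by (force simp: N_def)
qed

section \<open>Eigenvector expansions and coefficientwise inversion of \<open>A - z\<close>\<close>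

lemma expansion: "((\<lambda>k. cinner x (u k) *\<^sub>C u k) has_sum x) UNIV"
proof -
  obtain y where y: "((\<lambda>k. cinner x (u k) *\<^sub>C u k) has_sum y) UNIV"
    using orthonormal_summable_on[OF ortho Bessel_inequality[OF ortho]] by (auto simp: summable_on_def)
  have "cinner (x - y) (u k) = 0" for k
    using cinner_has_sum_orthonormal[OF ortho y] by (simp add: cinner.diff_left)
  then have "x - y = 0" by (rule eigenvectors_complete)
  with y show ?thesis by simp
qed

lemma Parseval: "((\<lambda>k. cinner x (u k) * cnj (cinner y (u k))) has_sum cinner x y) UNIV"
  using has_sum_cinner_left[OF expansion, of x y]
  by (simp add: cinner_scaleC_left flip: cinner_commute)

text \<open>If \<open>z = \<lambda>\<^sub>k\<close>, the formula for the coefficients reads \<open>0 / 0 = 0\<close> at \<open>k\<close>, that is, it selects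
  the solution orthogonal to the eigenvector \<open>u\<^sub>k\<close>.\<close>

lemma reduced_resolvent:
  obtains C where "C \<ge> 0"
    "\<And>f. (\<And>k. complex_of_real (lam k) = z \<Longrightarrow> cinner f (u k) = 0) \<Longrightarrow>
      \<exists>x\<in>D. A x - z *\<^sub>C x = f \<and> norm x \<le> C * norm f \<and>
        (\<forall>k. cinner x (u k) = cinner f (u k) / (complex_of_real (lam k) - z))"
proof -
  obtain d where d: "d > 0" "\<And>k. complex_of_real (lam k) \<noteq> z \<Longrightarrow> d \<le> cmod (complex_of_real (lam k) - z)"
    using spectral_gap[of z] by metis
  have "\<exists>x\<in>D. A x - z *\<^sub>C x = f \<and> norm x \<le> 1 / d * norm f \<and>
        (\<forall>k. cinner x (u k) = cinner f (u k) / (complex_of_real (lam k) - z))"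
    if f: "\<And>k. complex_of_real (lam k) = z \<Longrightarrow> cinner f (u k) = 0" for f
  proof -
    define a where "a = (\<lambda>k. cinner f (u k) / (complex_of_real (lam k) - z))"
    let ?F = "finite_subsets_at_top UNIV :: int set filter"
    define X where "X = (\<lambda>F. \<Sum>k\<in>F. a k *\<^sub>C u k)"
    have a_le: "cmod (a k) \<le> 1 / d * cmod (cinner f (u k))" for k
    proof (cases "complex_of_real (lam k) = z")
      case False
      have "cmod (cinner f (u k)) / cmod (complex_of_real (lam k) - z) \<le> cmod (cinner f (u k)) / d"
        by (rule divide_left_mono) (use d(2)[OF False] d(1) False in auto)
      then show ?thesis by (simp add: a_def norm_divide)
    qed (use d in \<open>simp add: a_def\<close>)
    have a_sq: "(\<Sum>k\<in>F. (cmod (a k))\<^sup>2) \<le> (1 / d * norm f)\<^sup>2" if "finite F" for F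
    proof -
      have "(\<Sum>k\<in>F. (cmod (a k))\<^sup>2) \<le> (\<Sum>k\<in>F. (1 / d * cmod (cinner f (u k)))\<^sup>2)"
        by (intro sum_mono power_mono a_le) auto
      also have "\<dots> = (1 / d)\<^sup>2 * (\<Sum>k\<in>F. (cmod (cinner f (u k)))\<^sup>2)"
        by (simp only: sum_distrib_left power_mult_distrib)
      also have "\<dots> \<le> (1 / d)\<^sup>2 * (norm f)\<^sup>2"
        by (intro mult_left_mono Bessel_inequality[OF ortho that]) auto
      finally show ?thesis by (simp only: power_mult_distrib)
    qed
    obtain x where x: "((\<lambda>k. a k *\<^sub>C u k) has_sum x) UNIV"
      using orthonormal_summable_on[OF ortho a_sq] by (auto simp: summable_on_def)
    have X_lim: "(X \<longlongrightarrow> x) ?F"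
      using x unfolding has_sum_def X_def .
    have X_D: "X F \<in> D" and X_A: "A (X F) = (\<Sum>k\<in>F. cinner f (u k) *\<^sub>C u k) + z *\<^sub>C X F"
      if "finite F" for F
    proof -
      have "X F \<in> D \<and> A (X F) = (\<Sum>k\<in>F. A (a k *\<^sub>C u k))"
        unfolding X_def by (rule op_sum[OF that]) (simp add: dom u_dom)
      moreover have "A (a k *\<^sub>C u k) = cinner f (u k) *\<^sub>C u k + z *\<^sub>C a k *\<^sub>C u k" for k
      proof -
        \<comment> \<open>At \<open>lam k = z\<close> both sides vanish: the coefficient of
          \<open>f\<close> is zero by assumption and \<open>a k\<close> is zero as a quotient by
          zero.\<close>
        have "a k * complex_of_real (lam k) = cinner f (u k) + z * a k"
          using f[of k] by (cases "complex_of_real (lam k) = z") (auto simp: a_def divide_simps algebra_simps)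
        then show ?thesis
          by (simp add: op u_dom A_u scaleC_scaleC flip: scaleC_add_left)
      qed
      ultimately show "X F \<in> D" "A (X F) = (\<Sum>k\<in>F. cinner f (u k) *\<^sub>C u k) + z *\<^sub>C X F"
        by (simp_all add: X_def sum.distrib complex_vector.scale_sum_right)
    qed
    have ev: "eventually finite ?F"
      by (simp add: eventually_finite_subsets_at_top_weakI)
    \<comment> \<open>The images of the partial sums converge because \<open>f\<close> equals its
      own expansion; closedness of \<open>A\<close> then puts the limit \<open>x\<close> into the
      domain.\<close>
    have "((\<lambda>F. (\<Sum>k\<in>F. cinner f (u k) *\<^sub>C u k) + z *\<^sub>C X F) \<longlongrightarrow> f + z *\<^sub>C x) ?F"
      using expansion[of f] unfolding has_sum_def
      by (rule tendsto_add[OF _ bounded_linear.tendsto[OF bounded_linear_scaleC X_lim]])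
    then have "((\<lambda>F. A (X F)) \<longlongrightarrow> f + z *\<^sub>C x) ?F"
      by (rule Lim_transform_eventually) (use ev in \<open>auto elim!: eventually_mono simp: X_A\<close>)
    then have "x \<in> D \<and> A x = f + z *\<^sub>C x"
      using ev by (intro closed_op[OF X_lim]) (auto elim!: eventually_mono simp: X_D)
    moreover have "norm x \<le> 1 / d * norm f"
    proof (rule tendsto_upperbound[OF tendsto_norm[OF X_lim]])
      show "eventually (\<lambda>F. norm (X F) \<le> 1 / d * norm f) ?F"
        using ev
      proof (rule eventually_mono)
        fix F :: "int set" assume F: "finite F"
        have "(norm (X F))\<^sup>2 \<le> (1 / d * norm f)\<^sup>2"
          unfolding X_def norm_sum_orthonormal_sq[OF ortho F] by (rule a_sq[OF F])
        then show "norm (X F) \<le> 1 / d * norm f"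
          by (rule power2_le_imp_le) (use d in simp)
      qed
    qed simp
    moreover have "cinner x (u k) = a k" for k
      by (rule cinner_has_sum_orthonormal[OF ortho x])
    ultimately show ?thesis
      by (intro bexI[of _ x]) (auto simp: a_def)
  qed
  then show thesis
    using that[of "1 / d"] d(1) by simp
qed

lemma shift_kernel:
  assumes "x \<in> D" "A x - z *\<^sub>C x = 0" "complex_of_real (lam k) \<noteq> z"
  shows "cinner x (u k) = 0"
  using coeff_shift[OF assms(1), of z k] assms(2,3) by (simp add: cinner.zero_left)

lemma eigenspace_lam: "eigenspace D A (complex_of_real (lam k)) = range (\<lambda>c. c *\<^sub>C u k)"
proof
  show "eigenspace D A (complex_of_real (lam k)) \<subseteq> range (\<lambda>c. c *\<^sub>C u k)"
    using eigenvector_eq[of _ k] by (auto simp: eigenspace_def)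
  show "range (\<lambda>c. c *\<^sub>C u k) \<subseteq> eigenspace D A (complex_of_real (lam k))"
    by (auto simp: eigenspace_def dom op u_dom A_u scaleC_scaleC mult.commute)
qed

lemma eigenspace_trivial:
  assumes "\<And>k. complex_of_real (lam k) \<noteq> z"
  shows "eigenspace D A z = {0}"
proof
  show "eigenspace D A z \<subseteq> {0}"
  proof
    fix x assume "x \<in> eigenspace D A z"
    then have "x \<in> D" "A x - z *\<^sub>C x = 0" by (simp_all add: eigenspace_def)
    then have "x = 0"
      using shift_kernel assms by (intro eigenvectors_complete) blast
    then show "x \<in> {0}" by simp
  qed
  show "{0} \<subseteq> eigenspace D A z"
    using op(2)[OF dom(1), of 0] dom(1) by (simp add: eigenspace_def)
qed

section \<open>The perturbed operator\<close>

context
  fixes mu :: real and v :: 'a and L :: "'a \<Rightarrow> 'a"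
  assumes L: "L = rank_one_perturbation A mu v"
begin

lemma perturbed_linear: "linear_operator D L"
  unfolding L by (rule linear_operator_rank_one_perturbation[OF linear])

lemma perturbed_shift: "L x - z *\<^sub>C x = (A x - z *\<^sub>C x) + (complex_of_real mu * cinner x v) *\<^sub>C v"
  by (simp add: L rank_one_perturbation_def scaleC_scaleC)

text \<open>The operator \<open>A - z\<close> misses the direction \<open>u k\<close> in both kernel
  and range. As \<open>v\<close> has a component along \<open>u k\<close>, the rank-one term
  supplies the missing range direction and detects the kernel.\<close>

lemma sigma1_resolvent_set:
  assumes mu: "mu \<noteq> 0" and vk: "cinner v (u k) \<noteq> 0"
  shows "complex_of_real (lam k) \<in> resolvent_set D L"
proof -
  define z where "z = complex_of_real (lam k)"
  define m where "m = complex_of_real mu"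
  define vk' where "vk' = cinner v (u k)"
  have m: "m \<noteq> 0" and vk': "vk' \<noteq> 0" using mu vk by (simp_all add: m_def vk'_def)
  have uv: "cinner (u k) v = cnj vk'"
    unfolding vk'_def by (rule cinner_commute)
  obtain C where C: "C \<ge> 0"
    "\<And>f. (\<And>j. complex_of_real (lam j) = z \<Longrightarrow> cinner f (u j) = 0) \<Longrightarrow>
      \<exists>x\<in>D. A x - z *\<^sub>C x = f \<and> norm x \<le> C * norm f \<and>
        (\<forall>k. cinner x (u k) = cinner f (u k) / (complex_of_real (lam k) - z))"
    using reduced_resolvent[of z] by metis
  have Au: "A (a *\<^sub>C u k) - z *\<^sub>C a *\<^sub>C u k = 0" for a
    by (simp add: op u_dom A_u z_def scaleC_scaleC mult.commute)
  have norm_u: "norm (u k) = 1"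
    using ortho[of k k] by (simp add: norm_eq_sqrt_cinner)
  define K1 where "K1 = 1 + norm v / cmod vk'"
  \<comment> \<open>\<open>K1\<close> bounds the norm of \<open>g\<close> below relative to
    \<open>f\<close>; \<open>K\<close> adds the resulting bounds for \<open>y\<close> and for the
    coefficient \<open>a\<close> in \<open>x = y + a u_k\<close>.\<close>
  define K where "K = C * K1 + (1 / (cmod vk' * cmod m) + C * K1 * norm v) / cmod vk'"
  have K1: "K1 \<ge> 0" by (simp add: K1_def)
  show ?thesis
    unfolding z_def[symmetric]
  proof (rule resolvent_setI[OF perturbed_linear])
    fix x assume x: "x \<in> D" "L x - z *\<^sub>C x = 0"
    have "cinner (L x - z *\<^sub>C x) (u k) = m * cinner x v * vk'"
      unfolding perturbed_shift cinner.add_left coeff_shift[OF x(1)] cinner_scaleC_left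
      by (simp add: z_def m_def vk'_def)
    then have xv: "cinner x v = 0"
      using x(2) m vk' by (simp add: cinner.zero_left)
    then have "A x - z *\<^sub>C x = 0"
      using x(2) by (simp add: perturbed_shift)
    then have "x = cinner x (u k) *\<^sub>C u k"
      using x(1) by (intro eigenvector_eq) (auto simp: z_def)
    moreover from this have "cinner x (u k) * cnj vk' = 0"
      using xv by (metis cinner_scaleC_left uv)
    ultimately show "x = 0" using vk' by auto
  next
    fix f :: 'a
    \<comment> \<open>Pairing \<open>(L - z) x = f\<close> with \<open>u k\<close> forces
      \<open>m * cinner x v = c\<close>. Subtracting \<open>c\<close> times \<open>v\<close> leaves
      a vector orthogonal to \<open>u k\<close>, to which the reduced resolvent applies.\<close>
    define c where "c = cinner f (u k) / vk'"
    define g where "g = f - c *\<^sub>C v"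
    have c_le: "cmod c \<le> norm f / cmod vk'"
      using cinner_Cauchy_Schwarz[of f "u k"]
      by (simp add: c_def norm_divide norm_u divide_right_mono)
    have "cmod c * norm v \<le> norm f / cmod vk' * norm v"
      by (intro mult_right_mono c_le) auto
    then have g_le: "norm g \<le> K1 * norm f"
      using norm_triangle_ineq4[of f "c *\<^sub>C v"]
      by (simp add: g_def K1_def norm_scaleC algebra_simps)
    have "cinner g (u k) = 0"
      using vk' by (simp add: g_def c_def cinner.diff_left cinner_scaleC_left flip: vk'_def)
    then have "cinner g (u j) = 0" if "complex_of_real (lam j) = z" for j
      using that by (simp add: z_def inj_lam)
    then obtain y where y: "y \<in> D" "A y - z *\<^sub>C y = g" "norm y \<le> C * norm g"
      using C(2)[of g] by blast
    have "C * norm g \<le> C * (K1 * norm f)" using g_le C(1) by (rule mult_left_mono)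
    with y(3) have y_le: "norm y \<le> C * K1 * norm f" by simp
    \<comment> \<open>Adding a multiple of \<open>u k\<close> does not change
      \<open>(A - z) y\<close>; this multiple gives \<open>cinner x v\<close> the forced value
      \<open>c / m\<close>.\<close>
    define a where "a = (c / m - cinner y v) / cnj vk'"
    have "cmod (cinner y v) \<le> C * K1 * norm f * norm v"
      using cinner_Cauchy_Schwarz[of y v] mult_right_mono[OF y_le, of "norm v"] by simp
    moreover have "cmod (c / m) \<le> norm f / cmod vk' / cmod m"
      unfolding norm_divide by (rule divide_right_mono[OF c_le]) simp
    ultimately have "cmod (c / m - cinner y v) \<le> norm f / cmod vk' / cmod m + C * K1 * norm f * norm v"
      using norm_triangle_ineq4[of "c / m" "cinner y v"] by linarith
    then have a_le: "cmod a \<le> (norm f / cmod vk' / cmod m + C * K1 * norm f * norm v) / cmod vk'"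
      by (simp add: a_def norm_divide divide_right_mono)
    define x where "x = y + a *\<^sub>C u k"
    have xD: "x \<in> D" using y(1) by (simp add: x_def dom u_dom)
    have "m * cinner x v = c"
      using m vk' by (simp add: x_def cinner.add_left cinner_scaleC_left uv a_def distrib_left)
    moreover have "A x - z *\<^sub>C x = g"
      using Au[of a] y by (simp add: x_def op dom u_dom scaleC_add_right algebra_simps)
    ultimately have "L x - z *\<^sub>C x = f"
      unfolding perturbed_shift m_def[symmetric] by (simp add: g_def)
    moreover have "norm x \<le> norm y + cmod a"
      using norm_triangle_ineq[of y "a *\<^sub>C u k"] by (simp add: x_def norm_scaleC norm_u)
    with y_le a_le have "norm x \<le> K * norm f"
      by (simp add: K_def algebra_simps add_divide_distrib)
    ultimately show "\<exists>x\<in>D. L x - z *\<^sub>C x = f \<and> norm x \<le> K * norm f"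
      using xD by blast
  qed
qed

section \<open>Kernel and resolvent of \<open>L - z\<close> for \<open>z\<close> outside
  \<open>sigma1\<close>\<close>

lemma resolvent_vector:
  assumes z: "z \<notin> sigma1 lam u v"
  obtains y where "y \<in> D" "A y - z *\<^sub>C y = v"
    "\<And>k. cinner y (u k) = cinner v (u k) / (complex_of_real (lam k) - z)"
    "Q_fun lam u mu v z = 1 + complex_of_real mu * cinner y v"
proof -
  have "cinner v (u k) = 0" if "complex_of_real (lam k) = z" for k
    using z that by (auto simp: sigma1_def)
  then obtain y where y: "y \<in> D" "A y - z *\<^sub>C y = v"
    "\<And>k. cinner y (u k) = cinner v (u k) / (complex_of_real (lam k) - z)"
    using reduced_resolvent[of z] by metis
  \<comment> \<open>Indices outside \<open>sigma1\<close> have zero coefficient of \<open>v\<close>,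
    so the series in \<open>Q_fun\<close> is the Parseval series of
    \<open>cinner y v\<close>.\<close>
  have "((\<lambda>s. complex_of_real ((cmod (cinner v (u s)))\<^sup>2) / (complex_of_real (lam s) - z)) has_sum cinner y v)
      {s. complex_of_real (lam s) \<in> sigma1 lam u v}
    \<longleftrightarrow> ((\<lambda>k. cinner y (u k) * cnj (cinner v (u k))) has_sum cinner y v) UNIV"
    by (rule has_sum_cong_neutral)
      (auto simp: sigma1_def inj_lam y(3) complex_norm_square simp del: of_real_power)
  then have "Q_fun lam u mu v z = 1 + complex_of_real mu * cinner y v"
    unfolding Q_fun_def using Parseval[of y v] by (simp add: infsumI)
  with y show thesis using that by blast
qed

text \<open>At each index one factor of the Parseval series vanishes: the coefficient of
  \<open>x\<close> where \<open>lam k\<close> differs from \<open>z\<close>, that of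
  \<open>v\<close> where it equals \<open>z\<close>.\<close>

lemma eigenspace_orthogonal:
  assumes z: "z \<notin> sigma1 lam u v" and x: "x \<in> eigenspace D A z"
  shows "cinner x v = 0"
proof -
  have "cinner x (u k) * cnj (cinner v (u k)) = 0" for k
    using shift_kernel[of x z k] x z by (auto simp: eigenspace_def sigma1_def)
  then show ?thesis
    using Parseval[of x v] has_sum_0 has_sum_unique by (metis (no_types, lifting) UNIV_I)
qed

lemma perturbed_eigenspace:
  assumes z: "z \<notin> sigma1 lam u v"
    and y: "y \<in> D" "A y - z *\<^sub>C y = v" "Q_fun lam u mu v z = 1 + complex_of_real mu * cinner y v"
  shows "eigenspace D L z =
    {x + b *\<^sub>C y | x b. x \<in> eigenspace D A z \<and> b * Q_fun lam u mu v z = 0}"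
proof (intro equalityI subsetI)
  have eig: "x \<in> eigenspace D T z \<longleftrightarrow> x \<in> D \<and> T x - z *\<^sub>C x = 0" for x T
    by (auto simp: eigenspace_def)
  have shift: "A (x + b *\<^sub>C y) - z *\<^sub>C (x + b *\<^sub>C y) = A x - z *\<^sub>C x + b *\<^sub>C v" if "x \<in> D" for x b
  proof -
    have "b *\<^sub>C v = b *\<^sub>C A y - b *\<^sub>C z *\<^sub>C y"
      unfolding y(2)[symmetric] by (rule complex_vector.scale_right_diff_distrib)
    then show ?thesis
      using that y(1) by (simp add: op dom scaleC_add_right scaleC_scaleC mult.commute)
  qed
  {
    fix x assume "x \<in> eigenspace D L z"
    then have x: "x \<in> D" "L x - z *\<^sub>C x = 0" by (auto simp: eig)
    \<comment> \<open>With this \<open>b\<close>, the equation \<open>(L - z) x = 0\<close> reads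
      \<open>(A - z) x = b v\<close>, so subtracting \<open>b\<close> times \<open>y\<close> leaves
      a kernel vector of \<open>A - z\<close>. Such a vector is orthogonal to \<open>v\<close>, and
      the definition of \<open>b\<close> becomes the condition \<open>b Q = 0\<close>.\<close>
    define b where "b = - (complex_of_real mu * cinner x v)"
    define w where "w = x + (- b) *\<^sub>C y"
    have w: "w \<in> eigenspace D A z"
      unfolding eig w_def shift[OF x(1)]
      using x y(1) by (simp add: dom perturbed_shift b_def)
    have x_eq: "x = w + b *\<^sub>C y" by (simp add: w_def)
    have "cinner x v = b * cinner y v"
      unfolding x_eq using eigenspace_orthogonal[OF z w]
      by (simp add: cinner.add_left cinner_scaleC_left)
    then have "b * Q_fun lam u mu v z = b + complex_of_real mu * cinner x v"
      by (simp add: y(3) algebra_simps)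
    then have "b * Q_fun lam u mu v z = 0" by (simp add: b_def)
    with w x_eq show "x \<in> {x + b *\<^sub>C y | x b. x \<in> eigenspace D A z \<and> b * Q_fun lam u mu v z = 0}"
      by blast
  next
    fix x assume "x \<in> {x + b *\<^sub>C y | x b. x \<in> eigenspace D A z \<and> b * Q_fun lam u mu v z = 0}"
    then obtain w b where x: "x = w + b *\<^sub>C y" and w: "w \<in> eigenspace D A z"
      and b: "b * Q_fun lam u mu v z = 0" by blast
    have wD: "w \<in> D" "A w - z *\<^sub>C w = 0" using w by (auto simp: eig)
    have "cinner x v = b * cinner y v"
      unfolding x using eigenspace_orthogonal[OF z w]
      by (simp add: cinner.add_left cinner_scaleC_left)
    then have "b + complex_of_real mu * cinner x v = 0"
      using b by (simp add: y(3) algebra_simps)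
    then have "L x - z *\<^sub>C x = 0"
      unfolding perturbed_shift unfolding x shift[OF wD(1)] wD(2)
      by (simp flip: scaleC_add_left)
    then show "x \<in> eigenspace D L z"
      using wD y(1) by (simp add: eig x dom)
  }
qed

lemma perturbed_resolvent_set:
  assumes z: "z \<notin> sigma0 lam u v" "z \<notin> sigma1 lam u v" and Q: "Q_fun lam u mu v z \<noteq> 0"
  shows "z \<in> resolvent_set D L"
proof -
  have lam_z: "complex_of_real (lam k) \<noteq> z" for k
    using z by (auto simp: sigma0_def sigma1_def)
  obtain y where y: "y \<in> D" "A y - z *\<^sub>C y = v"
    "Q_fun lam u mu v z = 1 + complex_of_real mu * cinner y v"
    using resolvent_vector[OF z(2)] by metis
  define q where "q = Q_fun lam u mu v z"
  obtain C where C: "C \<ge> 0" "\<And>f. \<exists>x\<in>D. A x - z *\<^sub>C x = f \<and> norm x \<le> C * norm f"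
    using reduced_resolvent[of z] lam_z by metis
  define K where "K = C + cmod (complex_of_real mu / q) * C * norm v * norm y"
  show ?thesis
  proof (rule resolvent_setI[OF perturbed_linear])
    fix x assume "x \<in> D" "L x - z *\<^sub>C x = 0"
    then have "x \<in> eigenspace D L z" by (simp add: eigenspace_def)
    then show "x = 0"
      using Q eigenspace_trivial[OF lam_z] unfolding perturbed_eigenspace[OF z(2) y] by auto
  next
    fix f :: 'a
    obtain g where g: "g \<in> D" "A g - z *\<^sub>C g = f" "norm g \<le> C * norm f"
      using C(2)[of f] by blast
    \<comment> \<open>This is the rank-one resolvent formula: solve the unperturbed equation by
      \<open>g\<close>, then correct along \<open>y\<close>. Requiring
      \<open>mu * cinner x v = b\<close> for \<open>x = g - b y\<close> determines \<open>b\<close>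
      after division by \<open>q\<close>.\<close>
    define b where "b = complex_of_real mu / q * cinner g v"
    define x where "x = g - b *\<^sub>C y"
    have xD: "x \<in> D" using g y by (simp add: x_def op_diff dom)
    have "b *\<^sub>C v = b *\<^sub>C A y - b *\<^sub>C z *\<^sub>C y"
      unfolding y(2)[symmetric] by (rule complex_vector.scale_right_diff_distrib)
    then have "A x - z *\<^sub>C x = f - b *\<^sub>C v"
      using g y(1)
      by (simp add: x_def op_diff op dom complex_vector.scale_right_diff_distrib scaleC_scaleC
          mult.commute algebra_simps)
    moreover have "complex_of_real mu * cinner x v = b"
    proof -
      have "complex_of_real mu * cinner x v = b * q - b * (complex_of_real mu * cinner y v)"
        using Q by (simp add: x_def cinner.diff_left cinner_scaleC_left b_def q_def right_diff_distrib)
      then show ?thesis by (simp add: q_def y(3) algebra_simps)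
    qed
    ultimately have "L x - z *\<^sub>C x = f" by (simp add: perturbed_shift)
    moreover have "norm x \<le> K * norm f"
    proof -
      have "cmod (cinner g v) \<le> C * norm f * norm v"
        using cinner_Cauchy_Schwarz[of g v] mult_right_mono[OF g(3), of "norm v"] by simp
      then have "cmod b \<le> cmod (complex_of_real mu / q) * (C * norm f * norm v)"
        unfolding b_def norm_mult by (rule mult_left_mono) simp
      then have "cmod b * norm y \<le> cmod (complex_of_real mu / q) * (C * norm f * norm v) * norm y"
        by (rule mult_right_mono) simp
      then show ?thesis
        using norm_triangle_ineq4[of g "b *\<^sub>C y"] g(3)
        by (simp add: x_def K_def norm_scaleC algebra_simps)
    qed
    ultimately show "\<exists>x\<in>D. L x - z *\<^sub>C x = f \<and> norm x \<le> K * norm f"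
      using xD by blast
  qed
qed

section \<open>Multiplicities and the spectrum of the perturbed operator\<close>

lemma multiplicity_sigma0:
  assumes "z \<in> sigma0 lam u v" "Q_fun lam u mu v z \<noteq> 0"
  shows "eigenvalue_multiplicity D L z = 1"
proof -
  obtain k where k: "z = complex_of_real (lam k)" "cinner v (u k) = 0"
    using assms(1) by (auto simp: sigma0_def)
  then have z: "z \<notin> sigma1 lam u v" by (auto simp: sigma1_def inj_lam)
  obtain y where y: "y \<in> D" "A y - z *\<^sub>C y = v"
    "Q_fun lam u mu v z = 1 + complex_of_real mu * cinner y v"
    using resolvent_vector[OF z] by metis
  have "eigenspace D L z = eigenspace D A z"
    using assms(2) unfolding perturbed_eigenspace[OF z y] by auto
  also have "\<dots> = range (\<lambda>c. c *\<^sub>C u k)"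
    unfolding k(1) by (rule eigenspace_lam)
  finally show ?thesis
    by (simp add: eigenvalue_multiplicity_def dim_span_single u_nonzero)
qed

lemma multiplicity_sigma2:
  assumes "z \<in> sigma2 lam u mu v" "z \<notin> sigma0 lam u v"
  shows "eigenvalue_multiplicity D L z = 1"
proof -
  have z: "z \<notin> sigma1 lam u v" and Q: "Q_fun lam u mu v z = 0"
    using assms(1) by (auto simp: sigma2_def)
  have lam_z: "complex_of_real (lam k) \<noteq> z" for k
    using z assms(2) by (auto simp: sigma0_def sigma1_def)
  obtain y where y: "y \<in> D" "A y - z *\<^sub>C y = v"
    "Q_fun lam u mu v z = 1 + complex_of_real mu * cinner y v"
    using resolvent_vector[OF z] by metis
  have "y \<noteq> 0" using y(3) Q by (auto simp: cinner.zero_left)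
  moreover have "eigenspace D L z = range (\<lambda>c. c *\<^sub>C y)"
    unfolding perturbed_eigenspace[OF z y] eigenspace_trivial[OF lam_z] using Q by auto
  ultimately show ?thesis
    by (simp add: eigenvalue_multiplicity_def dim_span_single)
qed

text \<open>Both sources of eigenvectors contribute: \<open>u k\<close> survives because
  \<open>v\<close> is orthogonal to it, and \<open>y\<close> appears because \<open>Q_fun\<close>
  vanishes. They are independent, since \<open>y\<close> is nonzero and orthogonal to
  \<open>u k\<close>.\<close>

lemma multiplicity_sigma0_sigma2:
  assumes "z \<in> sigma0 lam u v" "z \<in> sigma2 lam u mu v"
  shows "eigenvalue_multiplicity D L z = 2"
proof -
  obtain k where k: "z = complex_of_real (lam k)" "cinner v (u k) = 0"
    using assms(1) by (auto simp: sigma0_def)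
  have z: "z \<notin> sigma1 lam u v" and Q: "Q_fun lam u mu v z = 0"
    using assms(2) by (auto simp: sigma2_def)
  obtain y where y: "y \<in> D" "A y - z *\<^sub>C y = v"
    "Q_fun lam u mu v z = 1 + complex_of_real mu * cinner y v"
    and yk: "\<And>k. cinner y (u k) = cinner v (u k) / (complex_of_real (lam k) - z)"
    using resolvent_vector[OF z] by metis
  have y_nz: "y \<noteq> 0" using y(3) Q by (auto simp: cinner.zero_left)
  have "cinner y (u k) = 0" using yk[of k] k by simp
  then have "y \<notin> range (\<lambda>c. c *\<^sub>C u k)"
    using y_nz by (auto simp: cinner_scaleC_left ortho)
  then have y_span: "y \<notin> complex_vector.span {u k}"
    by (simp add: complex_vector.span_singleton)
  then have indep: "complex_vector.independent {y, u k}" and "y \<noteq> u k"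
    using u_nonzero by (auto simp: complex_vector.independent_insert complex_vector.span_base)
  have "x \<in> eigenspace D L z \<longleftrightarrow> (\<exists>b c. x = c *\<^sub>C u k + b *\<^sub>C y)" for x
    unfolding perturbed_eigenspace[OF z y] unfolding k(1) eigenspace_lam using Q k(1) by auto
  moreover have "x \<in> complex_vector.span {y, u k} \<longleftrightarrow> (\<exists>b c. x = c *\<^sub>C u k + b *\<^sub>C y)" for x
    by (simp add: complex_vector.span_insert[of y] complex_vector.span_singleton image_iff diff_eq_eq)
  ultimately have "eigenspace D L z = complex_vector.span {y, u k}" by blast
  with \<open>y \<noteq> u k\<close> complex_vector.dim_span_eq_card_independent[OF indep] show ?thesis
    by (simp add: eigenvalue_multiplicity_def)
qed

text \<open>The assumption keeps \<open>sigma1\<close> out of the spectrum: its points are regular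
  if \<open>mu\<close> is nonzero, and it is empty if \<open>v = 0\<close>.\<close>

lemma perturbed_spectrum:
  assumes "mu \<noteq> 0 \<or> v = 0"
  shows "spectrum D L = sigma0 lam u v \<union> sigma2 lam u mu v"
proof (intro equalityI subsetI)
  fix z assume z: "z \<in> spectrum D L"
  have "z \<notin> sigma1 lam u v"
  proof
    assume "z \<in> sigma1 lam u v"
    then obtain k where "z = complex_of_real (lam k)" "cinner v (u k) \<noteq> 0"
      by (auto simp: sigma1_def)
    then show False
      using z assms sigma1_resolvent_set[of k] by (auto simp: spectrum_def cinner.zero_left)
  qed
  then show "z \<in> sigma0 lam u v \<union> sigma2 lam u mu v"
    using z perturbed_resolvent_set[of z] by (auto simp: sigma2_def spectrum_def)
next
  fix z assume z: "z \<in> sigma0 lam u v \<union> sigma2 lam u mu v"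
  have "eigenvalue_multiplicity D L z \<noteq> 0"
  proof (cases "z \<in> sigma2 lam u mu v")
    case True
    then show ?thesis
      using multiplicity_sigma2[of z] multiplicity_sigma0_sigma2[of z]
      by (cases "z \<in> sigma0 lam u v") auto
  next
    case False
    with z have "z \<in> sigma0 lam u v" "Q_fun lam u mu v z \<noteq> 0"
      by (auto simp: sigma0_def sigma1_def sigma2_def inj_lam)
    then show ?thesis using multiplicity_sigma0 by simp
  qed
  \<comment> \<open>A subset of \<open>{0}\<close> is spanned by the empty set and has dimension 0,
    so a nonzero multiplicity yields an eigenvector.\<close>
  then have "\<not> eigenspace D L z \<subseteq> {0}"
    using complex_vector.dim_le_card[of "eigenspace D L z" "{}"]
    by (auto simp: eigenvalue_multiplicity_def)
  then show "z \<in> spectrum D L"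
    using eigenvalue_in_spectrum[OF perturbed_linear] by blast
qed

end

end

theorem theorem2p1:
  fixes D :: "'a::complex_hilbert_space set"
    and L0 L :: "'a \<Rightarrow> 'a"
    and lam :: "int \<Rightarrow> real"
    and u :: "int \<Rightarrow> 'a"
    and mu :: real
    and v :: 'a
  assumes "selfadjoint D L0"
    and "simple_discrete_spectrum D L0 lam"
    and "orthonormal_eigenvectors D L0 lam u"
    and "L = rank_one_perturbation L0 mu v"
    and "mu \<noteq> 0 \<or> v = 0"
  defines "s0 \<equiv> sigma0 lam u v"
    and "s2 \<equiv> sigma2 lam u mu v"
  shows "spectrum D L = (s0 - (s0 \<inter> s2)) \<union> (s2 - (s0 \<inter> s2)) \<union> (s0 \<inter> s2)
    \<and> (\<forall>z \<in> s0 - (s0 \<inter> s2). eigenvalue_multiplicity D L z = 1)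
    \<and> (\<forall>z \<in> s2 - (s0 \<inter> s2). eigenvalue_multiplicity D L z = 1)
    \<and> (\<forall>z \<in> s0 \<inter> s2. eigenvalue_multiplicity D L z = 2)"
proof -
  interpret simple_discrete_operator D L0 lam u
    by unfold_locales (fact assms)+
  \<comment> \<open>Since \<open>lam\<close> is injective, \<open>s0\<close> avoids
    \<open>sigma1\<close>. A point of \<open>s0\<close> outside \<open>s2\<close> therefore has
    \<open>Q_fun\<close> nonzero, rather than being excluded from \<open>s2\<close> as a
    pole.\<close>
  have "z \<notin> sigma1 lam u v" if "z \<in> s0" for z
    using that by (auto simp: s0_def sigma0_def sigma1_def inj_lam)
  then have "eigenvalue_multiplicity D L z = 1" if "z \<in> s0" "z \<notin> s2" for z
    using that multiplicity_sigma0[OF assms(4), of z] by (simp add: s0_def s2_def sigma2_def)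
  moreover have "spectrum D L = s0 \<union> s2"
    unfolding s0_def s2_def by (rule perturbed_spectrum[OF assms(4,5)])
  ultimately show ?thesis
    using multiplicity_sigma2[OF assms(4)] multiplicity_sigma0_sigma2[OF assms(4)]
    by (auto simp: s0_def s2_def)
qed

end
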